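(* Let $G$ be a finitely generated metabelian group which admits an automorphism $\iota$ that induces the automorphism $gG' \mapsto g^{-1}G'$ on the abelianisation $G_{\mathrm{ab}} = G/G'$ of $G$. Then $G$ admits a finite presentation if, and only if, it is polycyclic.
   Context: $G'$ denotes the derived (commutator) subgroup of $G$ and $G''=(G')'$. A group $G$ is metabelian if $G''$ is trivial. *)

theory Defs
  imports "HOL-Algebra.Elementary_Groups"
begin

definition finitely_generated :: "('a, 'b) monoid_scheme \<Rightarrow> bool" where
  "finitely_generated G \<longleftrightarrow> (\<exists>S \<subseteq> carrier G. finite S \<and> generate G S = carrier G)"

definition metabelian :: "('a, 'b) monoid_scheme \<Rightarrow> bool" where
  "metabelian G \<longleftrightarrow> derived G (derived G (carrier G)) = {\<one>\<^bsub>G\<^esub>}"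

inductive polycyclic_seq :: "('a, 'b) monoid_scheme \<Rightarrow> 'a set \<Rightarrow> bool" for G where
  unity: "polycyclic_seq G {\<one>\<^bsub>G\<^esub>}"
| extension: "\<lbrakk> polycyclic_seq G K; K \<lhd> (G \<lparr> carrier := H \<rparr>); subgroup H G;
                cyclic_group ((G \<lparr> carrier := H \<rparr>) Mod K) \<rbrakk> \<Longrightarrow> polycyclic_seq G H"

definition polycyclic :: "('a, 'b) monoid_scheme \<Rightarrow> bool" where
  "polycyclic G \<longleftrightarrow> polycyclic_seq G (carrier G)"

text \<open>The free group on a set \<open>X\<close> consists of the reduced words in the letters
  \<open>(x, True)\<close>, standing for the generator \<open>x\<close>, and \<open>(x, False)\<close>, standing for its inverse.\<close>

type_synonym 'x letter = "'x \<times> bool"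

fun inv_letter :: "'x letter \<Rightarrow> 'x letter" where
  "inv_letter (x, b) = (x, \<not> b)"

fun reduced :: "'x letter list \<Rightarrow> bool" where
  "reduced (a # b # w) \<longleftrightarrow> b \<noteq> inv_letter a \<and> reduced (b # w)"
| "reduced _ \<longleftrightarrow> True"

fun red_cons :: "'x letter \<Rightarrow> 'x letter list \<Rightarrow> 'x letter list" where
  "red_cons a [] = [a]"
| "red_cons a (b # w) = (if b = inv_letter a then w else a # b # w)"

definition free_group :: "'x set \<Rightarrow> 'x letter list monoid" where
  "free_group X =
     \<lparr> carrier = {w. reduced w \<and> set w \<subseteq> X \<times> UNIV},
       mult = (\<lambda>u v. foldr red_cons u v),
       one = [] \<rparr>"

definition normal_closure :: "('a, 'b) monoid_scheme \<Rightarrow> 'a set \<Rightarrow> 'a set" where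
  "normal_closure G R = \<Inter> {N. N \<lhd> G \<and> R \<subseteq> N}"

definition finitely_presented :: "('a, 'b) monoid_scheme \<Rightarrow> bool" where
  "finitely_presented G \<longleftrightarrow>
     (\<exists>(n::nat) R. finite R \<and> R \<subseteq> carrier (free_group {..<n}) \<and>
        G \<cong> free_group {..<n} Mod normal_closure (free_group {..<n}) R)"

lemma inv_letter_inv_letter [simp]: "inv_letter (inv_letter a) = a"
  by (cases a) auto

lemma inv_letter_neq [simp]: "inv_letter a \<noteq> a" "a \<noteq> inv_letter a"
  by (cases a; auto)+

lemma inv_letter_in_iff [simp]: "inv_letter a \<in> X \<times> UNIV \<longleftrightarrow> a \<in> X \<times> UNIV"
  by (cases a) auto

lemma reduced_tl: "reduced (a # w) \<Longrightarrow> reduced w"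
  by (cases w) auto

lemma reduced_red_cons: "reduced w \<Longrightarrow> reduced (red_cons a w)"
  by (cases w) (auto dest: reduced_tl)

lemma set_red_cons: "set (red_cons a w) \<subseteq> insert a (set w)"
  by (cases w) auto

lemma red_cons_cancel: "reduced w \<Longrightarrow> red_cons a (red_cons (inv_letter a) w) = w"
proof (cases w)
  case (Cons b v)
  assume "reduced w"
  with Cons show ?thesis by (cases v) auto
qed auto

lemma red_cons_reduced: "reduced (a # w) \<Longrightarrow> red_cons a w = a # w"
  by (cases w) auto

lemma reduced_foldr: "reduced v \<Longrightarrow> reduced (foldr red_cons u v)"
  by (induction u) (auto intro: reduced_red_cons)

lemma set_foldr_red_cons: "set (foldr red_cons u v) \<subseteq> set u \<union> set v"
  by (induction u) (use set_red_cons in fastforce)+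

lemma foldr_red_cons_red_cons:
  assumes "reduced z"
  shows "foldr red_cons (red_cons a w) z = red_cons a (foldr red_cons w z)"
proof (cases w)
  case (Cons b v)
  then show ?thesis
    using red_cons_cancel[OF reduced_foldr[OF assms, of v], of a] by auto
qed auto

lemma foldr_red_cons_assoc:
  "reduced z \<Longrightarrow>
     foldr red_cons (foldr red_cons u v) z = foldr red_cons u (foldr red_cons v z)"
  by (induction u) (auto simp: foldr_red_cons_red_cons)

lemma foldr_red_cons_Nil: "reduced u \<Longrightarrow> foldr red_cons u [] = u"
proof (induction u)
  case (Cons a u)
  then show ?case using reduced_tl[OF Cons.prems] by (simp add: red_cons_reduced)
qed simp

lemma foldr_red_cons_inverse:
  "reduced z \<Longrightarrow> foldr red_cons (map inv_letter (rev u)) (foldr red_cons u z) = z"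
proof (induction u arbitrary: z)
  case (Cons a u)
  then show ?case
    using red_cons_cancel[OF reduced_foldr[OF Cons.prems, of u], of "inv_letter a"] by auto
qed auto

theorem group_free_group: "group (free_group X)"
proof (rule groupI)
  fix u assume u: "u \<in> carrier (free_group X)"
  let ?v = "foldr red_cons (map inv_letter (rev u)) []"
  have "set ?v \<subseteq> X \<times> UNIV"
    using set_foldr_red_cons[of "map inv_letter (rev u)" "[]"] u
    by (fastforce simp: free_group_def)
  then have "?v \<in> carrier (free_group X)"
    using reduced_foldr[of "[]"] by (simp add: free_group_def)
  moreover have "?v \<otimes>\<^bsub>free_group X\<^esub> u = \<one>\<^bsub>free_group X\<^esub>"
    using u foldr_red_cons_inverse[of "[]" u]
    by (simp add: free_group_def foldr_red_cons_assoc foldr_red_cons_Nil)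
  ultimately show "\<exists>v\<in>carrier (free_group X). v \<otimes>\<^bsub>free_group X\<^esub> u = \<one>\<^bsub>free_group X\<^esub>"
    by blast
next
  fix u v assume "u \<in> carrier (free_group X)" "v \<in> carrier (free_group X)"
  then show "u \<otimes>\<^bsub>free_group X\<^esub> v \<in> carrier (free_group X)"
    using set_foldr_red_cons[of u v] by (auto simp: free_group_def reduced_foldr)
qed (auto simp: free_group_def foldr_red_cons_assoc)

end

theory Submission
  imports Defs
begin

text \<open>A polycyclic group is finitely presented because finite presentability passes to extensions
  by cyclic groups. For the converse put \<open>A = G'\<close> and regard \<open>A\<close> as a module over the commutative
  ring \<open>\<int>[G/A]\<close>. It suffices to show that every \<open>z \<in> G\<close> is integral on \<open>A\<close>, that is, some monic integer
  polynomial in \<open>z\<close> kills \<open>A\<close>: then \<open>A\<close> is a finitely generated abelian group.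

  A central extension of a finitely presented \<open>G\<close> by \<open>V\<close> with cocycle \<open>c\<close> is reached from a free group,
  and the relators land in a finitely generated subgroup of \<open>V\<close>. Hence that subgroup contains
  \<open>c(a,b) - c(b,a)\<close> for all commuting \<open>a\<close>, \<open>b\<close>. Take a bilinear \<open>\<mu> : A \<times> A \<rightarrow> V\<close> over \<open>\<int>[G/A]\<close>. As \<open>\<iota>\<close> inverts
  the action, \<open>(a,b) \<mapsto> \<mu>(a, \<iota> b)\<close> is \<open>G\<close>-invariant, and cup product with the derivation
  \<open>D g = [z,g]\<close> gives the cocycle \<open>c(g,h) = \<mu>(D g, \<iota>(g \<cdot> D h))\<close>. On \<open>A\<close> the derivation is multiplication by
  \<open>z - 1\<close>, and replacing \<open>a\<close> by \<open>z \<cdot> a\<close> separates the two terms of the defect, so that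
  \<open>(z\<^sup>2 - 1) \<mu>(D a, D b)\<close> ranges over a finitely generated group. If some monic \<open>\<phi>\<close> in \<open>z\<close> maps \<open>A\<close> into a submodule
  that is cyclic modulo \<open>K\<close>, then \<open>\<mu>\<close> can be taken as the product of that cyclic module, pulled back along
  \<open>\<phi>\<close>, and \<open>\<int>\<close> being noetherian yields a monic polynomial in \<open>z\<close> mapping \<open>A\<close> into \<open>K\<close>. Descending along a
  finite list of module generators of \<open>A\<close> ends with one that kills \<open>A\<close>.\<close>

section \<open>Presentations and central extensions\<close>

lemma (in group) normal_closure_normal:
  assumes "R \<subseteq> carrier G"
  shows "normal_closure G R \<lhd> G"
proof -
  let ?\<N> = "{N. N \<lhd> G \<and> R \<subseteq> N}"
  have ne: "?\<N> \<noteq> {}"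
    using normal_self assms by blast
  have "subgroup (\<Inter>?\<N>) G"
    using ne by (intro subgroups_Inter) (auto intro: normal_imp_subgroup)
  moreover have "g \<otimes> h \<otimes> inv g \<in> \<Inter>?\<N>" if "g \<in> carrier G" "h \<in> \<Inter>?\<N>" for g h
    using that by (auto intro: normal.inv_op_closed2)
  ultimately show ?thesis
    unfolding normal_closure_def by (rule normal_invI)
qed

lemma normal_closure_incl: "R \<subseteq> normal_closure G R"
  by (auto simp: normal_closure_def)

lemma normal_closure_minimal: "N \<lhd> G \<Longrightarrow> R \<subseteq> N \<Longrightarrow> normal_closure G R \<subseteq> N"
  by (auto simp: normal_closure_def)

section \<open>Evaluation of words, and presentations as epimorphisms\<close>

fun letter_value :: "('a, 'b) monoid_scheme \<Rightarrow> ('x \<Rightarrow> 'a) \<Rightarrow> 'x letter \<Rightarrow> 'a" where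
  "letter_value G f (x, b) = (if b then f x else inv\<^bsub>G\<^esub> (f x))"

fun word_value :: "('a, 'b) monoid_scheme \<Rightarrow> ('x \<Rightarrow> 'a) \<Rightarrow> 'x letter list \<Rightarrow> 'a" where
  "word_value G f [] = \<one>\<^bsub>G\<^esub>"
| "word_value G f (a # w) = letter_value G f a \<otimes>\<^bsub>G\<^esub> word_value G f w"

context group
begin

lemma letter_value_closed:
  "f \<in> X \<rightarrow> carrier G \<Longrightarrow> a \<in> X \<times> UNIV \<Longrightarrow> letter_value G f a \<in> carrier G"
  by (cases a) auto

lemma word_value_closed:
  "f \<in> X \<rightarrow> carrier G \<Longrightarrow> set w \<subseteq> X \<times> UNIV \<Longrightarrow> word_value G f w \<in> carrier G"
  by (induction w) (use letter_value_closed in fastforce)+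

lemma letter_value_inv_letter:
  assumes "f \<in> X \<rightarrow> carrier G" "a \<in> X \<times> UNIV"
  shows "letter_value G f a \<otimes> letter_value G f (inv_letter a) = \<one>"
  using assms by (cases a) (auto simp: Pi_iff)

lemma word_value_red_cons:
  assumes f: "f \<in> X \<rightarrow> carrier G" and a: "a \<in> X \<times> UNIV" and w: "set w \<subseteq> X \<times> UNIV"
  shows "word_value G f (red_cons a w) = letter_value G f a \<otimes> word_value G f w"
proof (cases w)
  case (Cons b v)
  have c: "letter_value G f a \<in> carrier G" "letter_value G f (inv_letter a) \<in> carrier G"
    "word_value G f v \<in> carrier G"
    using letter_value_closed[OF f] word_value_closed[OF f] a w Cons by simp_all
  show ?thesis
    using letter_value_inv_letter[OF f a] c by (auto simp: Cons m_assoc[symmetric])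
qed auto

lemma word_value_foldr_red_cons:
  assumes f: "f \<in> X \<rightarrow> carrier G" and "set u \<subseteq> X \<times> UNIV" and v: "set v \<subseteq> X \<times> UNIV"
  shows "word_value G f (foldr red_cons u v) = word_value G f u \<otimes> word_value G f v"
  using assms(2)
proof (induction u)
  case Nil
  then show ?case using f v by (simp add: word_value_closed)
next
  case (Cons a u)
  have "set (foldr red_cons u v) \<subseteq> X \<times> UNIV"
    using set_foldr_red_cons[of u v] Cons.prems v by fastforce
  then show ?case
    using f v Cons
    by (simp add: word_value_red_cons letter_value_closed word_value_closed m_assoc)
qed

lemma word_value_hom:
  assumes f: "f \<in> X \<rightarrow> carrier G"
  shows "word_value G f \<in> hom (free_group X) G"
  using word_value_closed[OF f] word_value_foldr_red_cons[OF f]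
  by (intro homI) (simp_all add: free_group_def)

end

lemma free_generator_closed: "x \<in> X \<Longrightarrow> [(x, b)] \<in> carrier (free_group X)"
  by (simp add: free_group_def)

lemma inv_free_generator:
  assumes "x \<in> X"
  shows "inv\<^bsub>free_group X\<^esub> [(x, True)] = [(x, False)]"
proof (rule group.inv_equality[OF group_free_group])
  show "[(x, False)] \<otimes>\<^bsub>free_group X\<^esub> [(x, True)] = \<one>\<^bsub>free_group X\<^esub>"
    by (simp add: free_group_def)
qed (use assms in \<open>simp_all add: free_generator_closed\<close>)

text \<open>A reduced word \<open>a # w\<close> is the product of \<open>[a]\<close> and
  \<open>w\<close>, since nothing cancels; induction on the word then applies.\<close>

lemma free_group_generated:
  "generate (free_group X) ((\<lambda>x. [(x, True)]) ` X) = carrier (free_group X)"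
proof
  interpret F: group "free_group X" by (rule group_free_group)
  let ?S = "(\<lambda>x. [(x, True)]) ` X"
  have S: "?S \<subseteq> carrier (free_group X)"
    by (auto simp: free_generator_closed)
  show "generate (free_group X) ?S \<subseteq> carrier (free_group X)"
    by (rule F.generate_incl[OF S])
  have "w \<in> generate (free_group X) ?S" if "reduced w" "set w \<subseteq> X \<times> UNIV" for w
    using that
  proof (induction w)
    case Nil
    then show ?case using generate.one[of "free_group X"] by (simp add: free_group_def)
  next
    case (Cons a w)
    obtain x b where a: "a = (x, b)" "x \<in> X" using Cons.prems by (cases a) auto
    have "[a] \<in> generate (free_group X) ?S"
      using a generate.incl[of "[(x, True)]" ?S "free_group X"]
        generate.inv[of "[(x, True)]" ?S "free_group X"]
      by (cases b) (auto simp: inv_free_generator)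
    then have "[a] \<otimes>\<^bsub>free_group X\<^esub> w \<in> generate (free_group X) ?S"
      using Cons reduced_tl[of a w] by (intro generate.eng) auto
    then show ?case
      using Cons.prems by (simp add: free_group_def red_cons_reduced)
  qed
  then show "carrier (free_group X) \<subseteq> generate (free_group X) ?S"
    by (auto simp: free_group_def)
qed

text \<open>Composing the quotient map with the isomorphism turns a presentation into an epimorphism
  \<open>\<pi>\<close> with prescribed kernel, the form in which presentations are used
  below.\<close>

lemma (in group) finitely_presentedD:
  assumes "finitely_presented G"
  obtains n R \<pi> where "finite R" "R \<subseteq> carrier (free_group {..<n::nat})"
    "\<pi> \<in> hom (free_group {..<n}) G" "\<pi> ` carrier (free_group {..<n}) = carrier G"
    "kernel (free_group {..<n}) G \<pi> = normal_closure (free_group {..<n}) R"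
proof -
  obtain n R where R: "finite R" "R \<subseteq> carrier (free_group {..<n::nat})"
    and iso: "G \<cong> free_group {..<n} Mod normal_closure (free_group {..<n}) R"
    using assms unfolding finitely_presented_def by blast
  let ?F = "free_group {..<n}"
  let ?N = "normal_closure ?F R"
  interpret F: group ?F by (rule group_free_group)
  interpret N: normal ?N ?F by (rule F.normal_closure_normal[OF R(2)])
  obtain h where h: "h \<in> iso (?F Mod ?N) G"
    using iso iso_sym unfolding is_iso_def by blast
  then have hom: "h \<in> hom (?F Mod ?N) G" and bij: "bij_betw h (carrier (?F Mod ?N)) (carrier G)"
    by (auto simp: iso_def)
  let ?\<pi> = "\<lambda>w. h (?N #>\<^bsub>?F\<^esub> w)"
  have mem: "?N #>\<^bsub>?F\<^esub> w \<in> carrier (?F Mod ?N)" if "w \<in> carrier ?F" for w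
    using that by (simp add: carrier_FactGroup)
  have "?\<pi> \<in> hom ?F G"
    using N.r_coset_hom_Mod hom by (simp add: hom_def Pi_iff)
  moreover have "?\<pi> ` carrier ?F = carrier G"
    using bij by (simp add: bij_betw_def carrier_FactGroup image_image)
  moreover have "kernel ?F G ?\<pi> = ?N"
  proof -
    have one: "h ?N = \<one>"
      using hom_one[OF hom N.factorgroup_is_group is_group] by simp
    have "?\<pi> w = \<one> \<longleftrightarrow> w \<in> ?N" if w: "w \<in> carrier ?F" for w
    proof
      assume "?\<pi> w = \<one>"
      moreover have "?N \<in> carrier (?F Mod ?N)"
        using mem[OF F.one_closed] by (simp add: N.subset)
      ultimately have "?N #>\<^bsub>?F\<^esub> w = ?N"
        using bij mem[OF w] one by (auto simp: bij_betw_def inj_on_def)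
      then show "w \<in> ?N" using F.rcos_self[OF w N.subgroup_axioms] by simp
    next
      assume "w \<in> ?N"
      then show "?\<pi> w = \<one>" using one by (simp add: F.coset_join2[OF w N.subgroup_axioms])
    qed
    then show ?thesis using N.subset by (auto simp: kernel_def)
  qed
  ultimately show ?thesis using that R by blast
qed

lemma (in group) finitely_presentedI:
  assumes "finite R" "R \<subseteq> carrier (free_group {..<n::nat})"
    and "\<pi> \<in> hom (free_group {..<n}) G" "\<pi> ` carrier (free_group {..<n}) = carrier G"
    and "kernel (free_group {..<n}) G \<pi> = normal_closure (free_group {..<n}) R"
  shows "finitely_presented G"
proof -
  interpret F: group "free_group {..<n}" by (rule group_free_group)
  interpret group_hom "free_group {..<n}" G \<pi> by unfold_locales (rule assms(3))
  have "free_group {..<n} Mod kernel (free_group {..<n}) G \<pi> \<cong> G"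
    by (rule FactGroup_iso[OF assms(4)])
  then have "G \<cong> free_group {..<n} Mod kernel (free_group {..<n}) G \<pi>"
    by (rule group.iso_sym[OF normal.factorgroup_is_group[OF normal_kernel]])
  then show ?thesis
    using assms unfolding finitely_presented_def by auto
qed

section \<open>Central extensions and the commutator defect\<close>

definition central_extension ::
  "('a, 'b) monoid_scheme \<Rightarrow> ('c, 'd) monoid_scheme \<Rightarrow> ('a \<Rightarrow> 'a \<Rightarrow> 'c) \<Rightarrow> ('a \<times> 'c) monoid" where
  "central_extension G V c =
     \<lparr> carrier = carrier G \<times> carrier V,
       mult = (\<lambda>(g, v) (h, w). (g \<otimes>\<^bsub>G\<^esub> h, v \<otimes>\<^bsub>V\<^esub> w \<otimes>\<^bsub>V\<^esub> c g h)),
       one = (\<one>\<^bsub>G\<^esub>, \<one>\<^bsub>V\<^esub>) \<rparr>"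

text \<open>The two normalization axioms make the pair of neutral elements neutral in
  \<open>E\<close>, and make the pairs with first component \<open>\<one>\<close> central
  there.\<close>

locale normalized_cocycle = G: group G + V: comm_group V
  for G :: "('a, 'b) monoid_scheme" and V :: "('c, 'd) monoid_scheme" +
  fixes c :: "'a \<Rightarrow> 'a \<Rightarrow> 'c"
  assumes cocycle_closed: "g \<in> carrier G \<Longrightarrow> h \<in> carrier G \<Longrightarrow> c g h \<in> carrier V"
    and cocycle_one_left: "g \<in> carrier G \<Longrightarrow> c \<one>\<^bsub>G\<^esub> g = \<one>\<^bsub>V\<^esub>"
    and cocycle_one_right: "g \<in> carrier G \<Longrightarrow> c g \<one>\<^bsub>G\<^esub> = \<one>\<^bsub>V\<^esub>"
    and cocycle: "\<lbrakk> g \<in> carrier G; h \<in> carrier G; k \<in> carrier G \<rbrakk> \<Longrightarrow>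
      c g h \<otimes>\<^bsub>V\<^esub> c (g \<otimes>\<^bsub>G\<^esub> h) k = c h k \<otimes>\<^bsub>V\<^esub> c g (h \<otimes>\<^bsub>G\<^esub> k)"
begin

abbreviation "E \<equiv> central_extension G V c"

lemma group_central_extension: "group E"
proof (rule groupI)
  fix x assume "x \<in> carrier E"
  then obtain g v where x: "x = (g, v)" "g \<in> carrier G" "v \<in> carrier V"
    by (auto simp: central_extension_def)
  let ?y = "(inv\<^bsub>G\<^esub> g, inv\<^bsub>V\<^esub> v \<otimes>\<^bsub>V\<^esub> inv\<^bsub>V\<^esub> (c (inv\<^bsub>G\<^esub> g) g))"
  have "?y \<in> carrier E"
    using x by (simp add: central_extension_def cocycle_closed)
  moreover have "?y \<otimes>\<^bsub>E\<^esub> x = \<one>\<^bsub>E\<^esub>"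
    using x by (simp add: central_extension_def cocycle_closed V.m_ac V.r_inv_ex)
  ultimately show "\<exists>y \<in> carrier E. y \<otimes>\<^bsub>E\<^esub> x = \<one>\<^bsub>E\<^esub>" by blast
next
  fix x y z assume "x \<in> carrier E" "y \<in> carrier E" "z \<in> carrier E"
  then obtain g h k u v w where xyz: "x = (g, u)" "y = (h, v)" "z = (k, w)"
    and c: "g \<in> carrier G" "h \<in> carrier G" "k \<in> carrier G"
      "u \<in> carrier V" "v \<in> carrier V" "w \<in> carrier V"
    by (auto simp: central_extension_def)
  have "u \<otimes>\<^bsub>V\<^esub> v \<otimes>\<^bsub>V\<^esub> c g h \<otimes>\<^bsub>V\<^esub> w \<otimes>\<^bsub>V\<^esub> c (g \<otimes>\<^bsub>G\<^esub> h) k =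
      u \<otimes>\<^bsub>V\<^esub> v \<otimes>\<^bsub>V\<^esub> w \<otimes>\<^bsub>V\<^esub> (c g h \<otimes>\<^bsub>V\<^esub> c (g \<otimes>\<^bsub>G\<^esub> h) k)"
    using c by (simp add: cocycle_closed V.m_ac)
  also have "\<dots> = u \<otimes>\<^bsub>V\<^esub> v \<otimes>\<^bsub>V\<^esub> w \<otimes>\<^bsub>V\<^esub> (c h k \<otimes>\<^bsub>V\<^esub> c g (h \<otimes>\<^bsub>G\<^esub> k))"
    using c by (simp add: cocycle)
  also have "\<dots> = u \<otimes>\<^bsub>V\<^esub> (v \<otimes>\<^bsub>V\<^esub> w \<otimes>\<^bsub>V\<^esub> c h k) \<otimes>\<^bsub>V\<^esub> c g (h \<otimes>\<^bsub>G\<^esub> k)"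
    using c by (simp add: cocycle_closed V.m_ac)
  finally show "x \<otimes>\<^bsub>E\<^esub> y \<otimes>\<^bsub>E\<^esub> z = x \<otimes>\<^bsub>E\<^esub> (y \<otimes>\<^bsub>E\<^esub> z)"
    using c by (simp add: xyz central_extension_def G.m_assoc)
qed (auto simp: central_extension_def cocycle_closed cocycle_one_left)

text \<open>Lifting the generators of a presentation to \<open>E\<close> gives \<open>\<Phi>\<close>
  over \<open>\<pi>\<close>; let \<open>S\<close> collect the \<open>V\<close>-components of the
  relators. As \<open>V\<close> is central, the words with value in
  \<open>{\<one>} \<times> generate V S\<close> form a normal subgroup, which contains
  \<open>R\<close> and hence the kernel of \<open>\<pi>\<close>. For commuting \<open>a\<close>,
  \<open>b\<close> the commutator of two preimages lies in that kernel, and its value in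
  \<open>E\<close> is the defect.\<close>

lemma finite_presentation_commutator_defect:
  assumes "finitely_presented G"
  obtains S where "finite S" "S \<subseteq> carrier V"
    "\<And>a b. \<lbrakk> a \<in> carrier G; b \<in> carrier G; a \<otimes>\<^bsub>G\<^esub> b = b \<otimes>\<^bsub>G\<^esub> a \<rbrakk> \<Longrightarrow>
      c a b \<otimes>\<^bsub>V\<^esub> inv\<^bsub>V\<^esub> (c b a) \<in> generate V S"
proof -
  interpret E: group E by (rule group_central_extension)
  obtain n R \<pi> where R: "finite R" "R \<subseteq> carrier (free_group {..<n::nat})"
    and \<pi>: "\<pi> \<in> hom (free_group {..<n}) G" "\<pi> ` carrier (free_group {..<n}) = carrier G"
    and ker: "kernel (free_group {..<n}) G \<pi> = normal_closure (free_group {..<n}) R"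
    by (rule G.finitely_presentedD[OF assms])
  let ?F = "free_group {..<n}"
  interpret F: group ?F by (rule group_free_group)
  interpret \<pi>: group_hom ?F G \<pi> by unfold_locales (rule \<pi>)
  define f where "f i = (\<pi> [(i, True)], \<one>\<^bsub>V\<^esub>)" for i
  have f: "f \<in> {..<n} \<rightarrow> carrier E"
    by (auto simp: f_def central_extension_def free_generator_closed)
  define \<Phi> where "\<Phi> = word_value E f"
  interpret \<Phi>: group_hom ?F E \<Phi>
    using E.word_value_hom[OF f] by unfold_locales (simp add: \<Phi>_def)
  have fst_mult: "fst (x \<otimes>\<^bsub>E\<^esub> y) = fst x \<otimes>\<^bsub>G\<^esub> fst y" for x y
    by (simp add: central_extension_def split: prod.splits)
  have fst_hom: "fst \<in> hom E G"
    by (rule homI) (auto simp: fst_mult, auto simp: central_extension_def)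
  interpret fst: group_hom E G fst by unfold_locales (rule fst_hom)
  have fst_\<Phi>: "fst (\<Phi> w) = \<pi> w" if "w \<in> carrier ?F" for w
    using that unfolding free_group_generated[symmetric]
  proof (induction w rule: generate.induct)
    case one
    then show ?case by simp
  next
    case (incl w)
    then show ?case
      using \<pi>.hom_closed by (auto simp: \<Phi>_def f_def central_extension_def cocycle_one_right free_generator_closed)
  next
    case (inv w)
    then have "fst (\<Phi> w) = \<pi> w" "w \<in> carrier ?F"
      using \<pi>.hom_closed by (auto simp: \<Phi>_def f_def central_extension_def cocycle_one_right free_generator_closed)
    then show ?case by simp
  next
    case (eng u v)
    then show ?case by (simp add: free_group_generated fst_mult)
  qed
  define S where "S = (\<lambda>w. snd (\<Phi> w)) ` R"
  have S: "finite S" "S \<subseteq> carrier V"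
  proof -
    have "snd (\<Phi> w) \<in> carrier V" if "w \<in> R" for w
      using \<Phi>.hom_closed[of w] that R(2) by (force simp: central_extension_def)
    then show "finite S" "S \<subseteq> carrier V" using R by (auto simp: S_def)
  qed
  interpret S: subgroup "generate V S" V by (rule V.generate_is_subgroup[OF S(2)])
  define N where "N = {w \<in> carrier ?F. \<exists>v \<in> generate V S. \<Phi> w = (\<one>\<^bsub>G\<^esub>, v)}"
  have mult1: "(\<one>\<^bsub>G\<^esub>, v) \<otimes>\<^bsub>E\<^esub> (g, w) = (g, v \<otimes>\<^bsub>V\<^esub> w)"
    "(g, w) \<otimes>\<^bsub>E\<^esub> (\<one>\<^bsub>G\<^esub>, v) = (g, v \<otimes>\<^bsub>V\<^esub> w)"
    if "v \<in> carrier V" "g \<in> carrier G" "w \<in> carrier V" for v g w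
    using that by (auto simp: central_extension_def cocycle_one_left cocycle_one_right V.m_comm)
  have inv1: "inv\<^bsub>E\<^esub> (\<one>\<^bsub>G\<^esub>, v) = (\<one>\<^bsub>G\<^esub>, inv\<^bsub>V\<^esub> v)" if "v \<in> carrier V" for v
    by (rule E.inv_equality) (use that in \<open>auto simp: central_extension_def cocycle_one_left\<close>)
  have "N \<lhd> ?F"
  proof (rule F.normal_invI)
    show "subgroup N ?F"
    proof (rule F.subgroupI)
      show "N \<noteq> {}"
        using S.one_closed \<Phi>.hom_one by (auto simp: N_def central_extension_def intro!: exI[of _ "\<one>\<^bsub>?F\<^esub>"])
      show "inv\<^bsub>?F\<^esub> w \<in> N" if "w \<in> N" for w
        using that S.m_inv_closed S.mem_carrier by (auto simp: N_def inv1)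
      show "u \<otimes>\<^bsub>?F\<^esub> v \<in> N" if "u \<in> N" "v \<in> N" for u v
        using that S.m_closed S.mem_carrier by (auto simp: N_def mult1)
    qed (auto simp: N_def)
    show "g \<otimes>\<^bsub>?F\<^esub> w \<otimes>\<^bsub>?F\<^esub> inv\<^bsub>?F\<^esub> g \<in> N" if g: "g \<in> carrier ?F" and w: "w \<in> N" for g w
    proof -
      obtain v where v: "v \<in> generate V S" "\<Phi> w = (\<one>\<^bsub>G\<^esub>, v)" and w': "w \<in> carrier ?F"
        using w by (auto simp: N_def)
      obtain x y where xy: "\<Phi> g = (x, y)" "x \<in> carrier G" "y \<in> carrier V"
        using \<Phi>.hom_closed[OF g] by (auto simp: central_extension_def)
      have "\<Phi> g \<otimes>\<^bsub>E\<^esub> \<Phi> w = \<Phi> w \<otimes>\<^bsub>E\<^esub> \<Phi> g"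
        using v xy S.mem_carrier by (simp add: mult1)
      then have "\<Phi> (g \<otimes>\<^bsub>?F\<^esub> w \<otimes>\<^bsub>?F\<^esub> inv\<^bsub>?F\<^esub> g) = \<Phi> w"
        using g w' by (simp add: E.m_assoc \<Phi>.hom_closed)
      then show ?thesis using v w' g by (auto simp: N_def)
    qed
  qed
  moreover have "R \<subseteq> N"
  proof
    fix w assume w: "w \<in> R"
    then have "\<pi> w = \<one>\<^bsub>G\<^esub>"
      using ker normal_closure_incl[of R ?F] by (auto simp: kernel_def)
    then have "fst (\<Phi> w) = \<one>\<^bsub>G\<^esub>" using w R by (auto simp: fst_\<Phi>)
    then have "\<Phi> w = (\<one>\<^bsub>G\<^esub>, snd (\<Phi> w))" by (metis prod.collapse)
    then show "w \<in> N"
      using w R by (auto simp: N_def S_def intro!: generate.incl)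
  qed
  ultimately have ker_N: "kernel ?F G \<pi> \<subseteq> N"
    using ker normal_closure_minimal by metis
  show ?thesis
  proof (rule that[OF S])
    fix a b assume ab: "a \<in> carrier G" "b \<in> carrier G" "a \<otimes>\<^bsub>G\<^esub> b = b \<otimes>\<^bsub>G\<^esub> a"
    have "a \<in> \<pi> ` carrier ?F" "b \<in> \<pi> ` carrier ?F"
      by (simp_all only: \<pi>(2) ab)
    then obtain p q where pq: "p \<in> carrier ?F" "\<pi> p = a" "q \<in> carrier ?F" "\<pi> q = b"
      by (elim imageE) simp
    \<comment> \<open>Since \<open>p q = ?k (q p)\<close>, comparing the \<open>V\<close>-components
      of the images of both sides isolates the defect without computing inverses in
      \<open>E\<close>.\<close>
    let ?k = "p \<otimes>\<^bsub>?F\<^esub> q \<otimes>\<^bsub>?F\<^esub> inv\<^bsub>?F\<^esub> (q \<otimes>\<^bsub>?F\<^esub> p)"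
    have "?k \<in> kernel ?F G \<pi>"
      using pq ab by (simp add: kernel_def)
    then obtain s where s: "s \<in> generate V S" "\<Phi> ?k = (\<one>\<^bsub>G\<^esub>, s)"
      using ker_N by (auto simp: N_def)
    obtain v w where vw: "\<Phi> p = (a, v)" "\<Phi> q = (b, w)" "v \<in> carrier V" "w \<in> carrier V"
      using \<Phi>.hom_closed[of p] \<Phi>.hom_closed[of q] fst_\<Phi>[of p] fst_\<Phi>[of q] pq
      by (auto simp: central_extension_def)
    have "p \<otimes>\<^bsub>?F\<^esub> q = ?k \<otimes>\<^bsub>?F\<^esub> (q \<otimes>\<^bsub>?F\<^esub> p)"
      using pq by (simp add: F.m_assoc del: F.inv_mult_group)
    then have "\<Phi> p \<otimes>\<^bsub>E\<^esub> \<Phi> q = \<Phi> ?k \<otimes>\<^bsub>E\<^esub> (\<Phi> q \<otimes>\<^bsub>E\<^esub> \<Phi> p)"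
      using pq by (metis F.inv_closed F.m_closed \<Phi>.hom_mult)
    then have "v \<otimes>\<^bsub>V\<^esub> w \<otimes>\<^bsub>V\<^esub> c a b = s \<otimes>\<^bsub>V\<^esub> (w \<otimes>\<^bsub>V\<^esub> v \<otimes>\<^bsub>V\<^esub> c b a)"
      using s vw ab S.mem_carrier cocycle_closed
      by (auto simp: central_extension_def cocycle_one_left)
    then have "(v \<otimes>\<^bsub>V\<^esub> w) \<otimes>\<^bsub>V\<^esub> c a b = (v \<otimes>\<^bsub>V\<^esub> w) \<otimes>\<^bsub>V\<^esub> (s \<otimes>\<^bsub>V\<^esub> c b a)"
      using s vw ab S.mem_carrier cocycle_closed by (simp add: V.m_ac)
    then have "c a b = s \<otimes>\<^bsub>V\<^esub> c b a"
      using s vw ab S.mem_carrier cocycle_closed by simp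
    then have "c a b \<otimes>\<^bsub>V\<^esub> inv\<^bsub>V\<^esub> (c b a) = s"
      using s ab S.mem_carrier cocycle_closed by (simp add: V.m_assoc)
    then show "c a b \<otimes>\<^bsub>V\<^esub> inv\<^bsub>V\<^esub> (c b a) \<in> generate V S" using s by simp
  qed
qed

end

section \<open>Polycyclic groups are finitely presented\<close>

text \<open>The least positive element of \<open>J\<close> works, by division with remainder;
  \<open>d = 0\<close> covers the trivial case. Below, \<open>J\<close> is always a set of exponents
  of one group element.\<close>

lemma int_subgroup_principal:
  fixes J :: "int set"
  assumes zero: "0 \<in> J" and diff: "\<And>x y. x \<in> J \<Longrightarrow> y \<in> J \<Longrightarrow> x - y \<in> J"
  obtains d where "d \<in> J" "\<And>k. k \<in> J \<Longrightarrow> d dvd k"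
proof (cases "J = {0}")
  case True
  then show ?thesis using that[of 0] by simp
next
  case False
  then obtain x where x: "x \<in> J" "x \<noteq> 0" using zero by blast
  have neg: "- y \<in> J" if "y \<in> J" for y using diff[OF zero that] by simp
  have add: "y + z \<in> J" if "y \<in> J" "z \<in> J" for y z using diff[OF that(1) neg[OF that(2)]] by simp
  have mult_nat: "int n * y \<in> J" if "y \<in> J" for n y
    by (induction n) (use zero add that in \<open>auto simp: algebra_simps\<close>)
  have mult: "k * y \<in> J" if "y \<in> J" for k y
    using mult_nat[OF that] neg by (cases k) (metis, metis mult_minus_left)
  define P where "P n \<longleftrightarrow> n > 0 \<and> int n \<in> J" for n
  have "P (nat \<bar>x\<bar>)"
    using x neg by (auto simp: P_def abs_if)
  then have d: "P (LEAST n. P n)" by (rule LeastI)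
  let ?d = "int (LEAST n. P n)"
  have "?d dvd k" if "k \<in> J" for k
  proof -
    have "k mod ?d = k - (k div ?d) * ?d" by (simp add: minus_div_mult_eq_mod)
    then have "k mod ?d \<in> J"
      using diff[OF that mult] d by (simp add: P_def)
    moreover have "0 \<le> k mod ?d" "k mod ?d < ?d" using d by (auto simp: P_def)
    ultimately have "\<not> P (nat (k mod ?d))" using not_less_Least[of "nat (k mod ?d)" P] by auto
    then have "k mod ?d = 0"
      using \<open>k mod ?d \<in> J\<close> \<open>0 \<le> k mod ?d\<close> unfolding P_def by auto
    then show ?thesis by presburger
  qed
  then show ?thesis using that d by (auto simp: P_def)
qed

context group
begin

lemma mult_inv_mult_cancel:
  assumes "x \<in> carrier G" "y \<in> carrier G"
  shows "inv x \<otimes> (x \<otimes> y) = y" "x \<otimes> (inv x \<otimes> y) = y"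
  using assms by (simp_all add: m_assoc[symmetric])

text \<open>Invariance is asked under \<open>s\<close> and under \<open>inv s\<close>, since
  conjugation by \<open>s\<close> alone may map \<open>P\<close> onto a proper subgroup of
  itself.\<close>

lemma normal_if_normalized_by_generators:
  assumes P: "subgroup P G" and S: "S \<subseteq> carrier G" "generate G S = carrier G"
    and conj: "\<And>s p. s \<in> S \<Longrightarrow> p \<in> P \<Longrightarrow> s \<otimes> p \<otimes> inv s \<in> P \<and> inv s \<otimes> p \<otimes> s \<in> P"
  shows "P \<lhd> G"
proof (rule normal_invI[OF P])
  have pc: "p \<in> carrier G" if "p \<in> P" for p using subgroup.mem_carrier[OF P that] .
  fix g p assume "g \<in> carrier G" "p \<in> P"
  then have "g \<in> generate G S" using S by simp
  then show "g \<otimes> p \<otimes> inv g \<in> P" using \<open>p \<in> P\<close>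
  proof (induction g arbitrary: p rule: generate.induct)
    case one
    then show ?case using pc by simp
  next
    case (incl s)
    then show ?case using conj by simp
  next
    case (inv s)
    then show ?case using conj S by (metis inv_inv subsetD)
  next
    case (eng g h)
    have c: "g \<in> carrier G" "h \<in> carrier G" using eng(1,2) S by simp_all
    have "g \<otimes> (h \<otimes> p \<otimes> inv h) \<otimes> inv g \<in> P" using eng by blast
    then show ?case using c pc[OF eng.prems] by (simp add: inv_mult_group m_assoc)
  qed
qed

text \<open>Powers of \<open>y\<close> move to the right past elements of \<open>P\<close> at the
  cost of conjugating these, so products collect into the stated form.\<close>

lemma generated_mod_normal_cyclic:
  assumes P: "P \<lhd> G" and y: "y \<in> carrier G" and S: "S \<subseteq> insert y P" "generate G S = carrier G"
    and g: "g \<in> carrier G"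
  shows "\<exists>p \<in> P. \<exists>k::int. g = p \<otimes> y [^] k"
proof -
  interpret P: normal P G by (rule P)
  have "g \<in> generate G S" using g S by simp
  then show ?thesis
  proof (induction g rule: generate.induct)
    case one
    then show ?case using y by (intro bexI[of _ \<one>] exI[of _ 0]) auto
  next
    case (incl s)
    then consider "s = y" | "s \<in> P" using S by blast
    then show ?case
    proof cases
      case 1
      then show ?thesis using y by (intro bexI[of _ \<one>] exI[of _ 1]) auto
    next
      case 2
      then show ?thesis using y by (intro bexI[of _ s] exI[of _ 0]) auto
    qed
  next
    case (inv s)
    then consider "s = y" | "s \<in> P" using S by blast
    then show ?case
    proof cases
      case 1
      then show ?thesis using y by (intro bexI[of _ \<one>] exI[of _ "- 1"]) (auto simp: int_pow_neg)
    next
      case 2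
      then show ?thesis using y by (intro bexI[of _ "inv s"] exI[of _ 0]) auto
    qed
  next
    case (eng g h)
    then obtain p q k l where eq: "p \<in> P" "g = p \<otimes> y [^] (k::int)" "q \<in> P" "h = q \<otimes> y [^] (l::int)"
      by blast
    have "p \<otimes> (y [^] k \<otimes> q \<otimes> inv (y [^] k)) \<in> P"
      using eq y by (simp add: P.inv_op_closed2)
    moreover have "g \<otimes> h = p \<otimes> (y [^] k \<otimes> q \<otimes> inv (y [^] k)) \<otimes> y [^] (k + l)"
      using eq y by (simp add: int_pow_mult m_assoc mult_inv_mult_cancel)
    ultimately show ?case by blast
  qed
qed

lemma normal_set_mult_subgroup:
  assumes N: "N \<lhd> G" and L: "subgroup L G"
  shows "subgroup (N <#> L) G"
proof (rule subgroupI)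
  interpret N: normal N G by (rule N)
  interpret L: subgroup L G by (rule L)
  have NL: "x \<otimes> y \<in> N <#> L" if "x \<in> N" "y \<in> L" for x y
    using that unfolding set_mult_def by blast
  show "N <#> L \<subseteq> carrier G" by (auto simp: set_mult_def)
  show "N <#> L \<noteq> {}" using NL[OF N.one_closed L.one_closed] by blast
  fix a assume "a \<in> N <#> L"
  then obtain n u where a: "n \<in> N" "u \<in> L" "a = n \<otimes> u" by (auto simp: set_mult_def)
  have "inv a = (inv u \<otimes> inv n \<otimes> u) \<otimes> inv u"
    using a by (simp add: inv_mult_group m_assoc)
  moreover have "inv u \<otimes> inv n \<otimes> u \<in> N"
    using a by (simp add: N.inv_op_closed1)
  ultimately show "inv a \<in> N <#> L"
    using a NL[of "inv u \<otimes> inv n \<otimes> u" "inv u"] by simp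
  fix b assume "b \<in> N <#> L"
  then obtain m v where b: "m \<in> N" "v \<in> L" "b = m \<otimes> v" by (auto simp: set_mult_def)
  have "a \<otimes> b = (n \<otimes> (u \<otimes> m \<otimes> inv u)) \<otimes> (u \<otimes> v)"
    using a b by (simp add: m_assoc mult_inv_mult_cancel)
  moreover have "n \<otimes> (u \<otimes> m \<otimes> inv u) \<in> N"
    using a b by (simp add: N.inv_op_closed2)
  moreover have "u \<otimes> v \<in> L" using a b by simp
  ultimately show "a \<otimes> b \<in> N <#> L"
    using NL[of "n \<otimes> (u \<otimes> m \<otimes> inv u)" "u \<otimes> v"] by simp
qed

lemma polycyclic_seq_subgroup: "polycyclic_seq G H \<Longrightarrow> subgroup H G"
  by (induction rule: polycyclic_seq.induct) (auto simp: triv_subgroup)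

lemma finitely_presented_trivial: "finitely_presented (G\<lparr>carrier := {\<one>}\<rparr>)"
proof -
  interpret T: group "G\<lparr>carrier := {\<one>}\<rparr>"
    by (rule subgroup_imp_group[OF triv_subgroup])
  let ?F = "free_group {..<0::nat}"
  interpret F: group ?F by (rule group_free_group)
  have c: "carrier ?F = {[]}" by (auto simp: free_group_def)
  interpret N: normal "normal_closure ?F {}" ?F by (rule F.normal_closure_normal) simp
  have "normal_closure ?F {} = {[]}"
    using N.subset N.one_closed c by (auto simp: free_group_def)
  then have "kernel ?F (G\<lparr>carrier := {\<one>}\<rparr>) (\<lambda>_. \<one>) = normal_closure ?F {}"
    by (simp only: kernel_def c) simp
  moreover have "(\<lambda>_. \<one>) \<in> hom ?F (G\<lparr>carrier := {\<one>}\<rparr>)"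
    by (simp add: hom_def)
  moreover have "(\<lambda>_. \<one>) ` carrier ?F = carrier (G\<lparr>carrier := {\<one>}\<rparr>)"
    by (simp only: c) simp
  ultimately show ?thesis
    using T.finitely_presentedI[of "{}" 0] by blast
qed

text \<open>Relators of the extension: those of \<open>K\<close>, two for each generator of \<open>K\<close> that express its
  conjugates by \<open>t\<close> and \<open>t\<^sup>-\<^sup>1\<close> in \<open>K\<close>, and one that expresses the least power of \<open>t\<close> lying in \<open>K\<close>.\<close>

lemma finitely_presented_cyclic_extension:
  assumes K: "K \<lhd> G" and fp: "finitely_presented (G\<lparr>carrier := K\<rparr>)"
    and t: "t \<in> carrier G" and cyc: "\<And>g. g \<in> carrier G \<Longrightarrow> \<exists>k \<in> K. \<exists>n::int. g = k \<otimes> t [^] n"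
  shows "finitely_presented G"
proof -
  interpret K: normal K G by (rule K)
  interpret GK: group "G\<lparr>carrier := K\<rparr>" by (rule subgroup_imp_group[OF K.subgroup_axioms])
  obtain n R \<pi> where R: "finite R" "R \<subseteq> carrier (free_group {..<n::nat})"
    and \<pi>: "\<pi> \<in> hom (free_group {..<n}) (G\<lparr>carrier := K\<rparr>)"
      "\<pi> ` carrier (free_group {..<n}) = carrier (G\<lparr>carrier := K\<rparr>)"
    and ker: "kernel (free_group {..<n}) (G\<lparr>carrier := K\<rparr>) \<pi> = normal_closure (free_group {..<n}) R"
    by (rule GK.finitely_presentedD[OF fp])
  let ?L = "free_group {..<n}" and ?F = "free_group {..<Suc n}"
  \<comment> \<open>The free group on the first \<open>n\<close> letters is literally a subgroup of
    the one on \<open>Suc n\<close> letters, with the same multiplication. The extra letter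
    \<open>n\<close> stands for \<open>t\<close>.\<close>
  define L where "L = carrier ?L"
  interpret L: group ?L by (rule group_free_group)
  interpret F: group ?F by (rule group_free_group)
  have FL: "?F\<lparr>carrier := L\<rparr> = ?L" by (simp add: free_group_def L_def)
  have LF: "L \<subseteq> carrier ?F" unfolding L_def free_group_def by (simp add: less_Suc_eq) force
  have Lsub: "subgroup L ?F"
    by (rule F.group_incl_imp_subgroup[OF LF]) (simp add: FL L.is_group)
  interpret Ls: subgroup L ?F by (rule Lsub)
  let ?y = "[(n, True)]"
  have y: "?y \<in> carrier ?F" by (simp add: free_generator_closed)
  let ?SL = "(\<lambda>i. [(i, True)]) ` {..<n}"
  have SL: "?SL \<subseteq> L" by (auto simp: L_def free_generator_closed)
  have genL: "generate ?F ?SL = L"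
    using F.generate_consistent[OF SL Lsub] free_group_generated[of "{..<n}"]
    unfolding FL by (simp add: L_def)
  define f where "f i = (if i < n then \<pi> [(i, True)] else t)" for i
  have \<pi>K: "\<pi> w \<in> K" if "w \<in> L" for w
    using \<pi>(1) that by (auto simp: hom_def L_def)
  have xL: "[(i, True)] \<in> L" if "i < n" for i
    using that by (simp add: L_def free_generator_closed)
  have f: "f \<in> {..<Suc n} \<rightarrow> carrier G"
    using t K.mem_carrier[OF \<pi>K] xL by (auto simp: f_def)
  define \<phi> where "\<phi> = word_value G f"
  interpret \<phi>: group_hom ?F G \<phi>
    using word_value_hom[OF f] by unfold_locales (simp add: \<phi>_def)
  interpret \<pi>: group_hom ?L "G\<lparr>carrier := K\<rparr>" \<pi> by unfold_locales (rule \<pi>)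
  have \<phi>y: "\<phi> ?y = t" using t by (simp add: \<phi>_def f_def)
  have \<phi>L: "\<phi> w = \<pi> w" if "w \<in> L" for w
  proof -
    have "w \<in> generate ?L ?SL" using that free_group_generated[of "{..<n}"] by (simp add: L_def)
    then show ?thesis
    proof (induction w rule: generate.induct)
      case one
      then show ?case using \<phi>.hom_one \<pi>.hom_one by (simp add: free_group_def)
    next
      case (incl s)
      then show ?case using \<pi>K SL by (auto simp: \<phi>_def f_def)
    next
      case (inv s)
      then have "\<phi> s = \<pi> s" "s \<in> L" using \<pi>K SL by (auto simp: \<phi>_def f_def)
      moreover from this have "inv\<^bsub>?L\<^esub> s = inv\<^bsub>?F\<^esub> s"
        using F.m_inv_consistent[OF Lsub, of s] unfolding FL by simp
      moreover have "\<phi> (inv\<^bsub>?F\<^esub> s) = inv (\<phi> s)" if "s \<in> L"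
        using that LF by auto
      moreover have "\<pi> (inv\<^bsub>?L\<^esub> s) = inv\<^bsub>G\<lparr>carrier := K\<rparr>\<^esub> (\<pi> s)" if "s \<in> L"
        using that by (simp add: L_def)
      ultimately show ?case
        using m_inv_consistent[OF K.subgroup_axioms \<pi>K[of s]] by simp
    next
      case (eng u v)
      have uv: "u \<in> L" "v \<in> L"
        using eng(1,2) free_group_generated[of "{..<n}"] by (simp_all add: L_def)
      have "u \<otimes>\<^bsub>?L\<^esub> v = u \<otimes>\<^bsub>?F\<^esub> v" by (simp add: free_group_def)
      then show ?case
        using uv eng LF \<pi>.hom_mult[of u v] by (auto simp: L_def)
    qed
  qed
  have lift: "\<exists>w. w \<in> L \<and> \<pi> w = k" if "k \<in> K" for k
  proof -
    have "k \<in> \<pi> ` L" using that \<pi>(2) by (simp add: L_def)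
    then show ?thesis by blast
  qed
  have tK: "t \<otimes> k \<otimes> inv t \<in> K" "inv t \<otimes> k \<otimes> t \<in> K" if "k \<in> K" for k
    using that t by (auto intro: K.inv_op_closed1 K.inv_op_closed2)
  have "\<forall>i\<in>{..<n}. \<exists>w. w \<in> L \<and> \<pi> w = t \<otimes> \<pi> [(i, True)] \<otimes> inv t"
    using lift[OF tK(1)[OF \<pi>K[OF xL]]] by simp
  then obtain wp where wp: "\<And>i. i < n \<Longrightarrow> wp i \<in> L"
    "\<And>i. i < n \<Longrightarrow> \<pi> (wp i) = t \<otimes> \<pi> [(i, True)] \<otimes> inv t"
    by (metis lessThan_iff)
  have "\<forall>i\<in>{..<n}. \<exists>w. w \<in> L \<and> \<pi> w = inv t \<otimes> \<pi> [(i, True)] \<otimes> t"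
    using lift[OF tK(2)[OF \<pi>K[OF xL]]] by simp
  then obtain wm where wm: "\<And>i. i < n \<Longrightarrow> wm i \<in> L"
    "\<And>i. i < n \<Longrightarrow> \<pi> (wm i) = inv t \<otimes> \<pi> [(i, True)] \<otimes> t"
    by (metis lessThan_iff)
  \<comment> \<open>The exponents \<open>k\<close> with \<open>t [^] k \<in> K\<close> form a
    subgroup of the integers, generated by \<open>m\<close>; here \<open>m = 0\<close> when
    \<open>t\<close> has infinite order modulo \<open>K\<close>.\<close>
  obtain m where m: "t [^] (m::int) \<in> K" "\<And>k::int. t [^] k \<in> K \<Longrightarrow> m dvd k"
  proof (rule int_subgroup_principal[of "{k::int. t [^] k \<in> K}"])
    show "x - z \<in> {k::int. t [^] k \<in> K}" if "x \<in> {k::int. t [^] k \<in> K}" "z \<in> {k::int. t [^] k \<in> K}" for x z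
      using that t by (simp add: int_pow_diff)
  qed (use t in auto)
  obtain w0 where w0: "w0 \<in> L" "\<pi> w0 = t [^] m" using lift[OF m(1)] by blast
  define rp where "rp i = ?y \<otimes>\<^bsub>?F\<^esub> [(i, True)] \<otimes>\<^bsub>?F\<^esub> inv\<^bsub>?F\<^esub> ?y \<otimes>\<^bsub>?F\<^esub> inv\<^bsub>?F\<^esub> (wp i)" for i
  define rm where "rm i = inv\<^bsub>?F\<^esub> ?y \<otimes>\<^bsub>?F\<^esub> [(i, True)] \<otimes>\<^bsub>?F\<^esub> ?y \<otimes>\<^bsub>?F\<^esub> inv\<^bsub>?F\<^esub> (wm i)" for i
  define r0 where "r0 = ?y [^]\<^bsub>?F\<^esub> m \<otimes>\<^bsub>?F\<^esub> inv\<^bsub>?F\<^esub> w0"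
  define R' where "R' = R \<union> rp ` {..<n} \<union> rm ` {..<n} \<union> {r0}"
  have xF: "[(i, True)] \<in> carrier ?F" "[(i, True)] \<in> L" if "i < n" for i
    using that SL LF by auto
  have wF: "wp i \<in> carrier ?F" "wm i \<in> carrier ?F" if "i < n" for i
    using wp(1)[OF that] wm(1)[OF that] LF by auto
  have rpF: "rp i \<in> carrier ?F" and rmF: "rm i \<in> carrier ?F" if "i < n" for i
    using xF[OF that] wF[OF that] y by (simp_all add: rp_def rm_def)
  have w0F: "w0 \<in> carrier ?F" using w0 LF by blast
  have r0F: "r0 \<in> carrier ?F" using w0F y by (simp add: r0_def)
  have R': "R' \<subseteq> carrier ?F"
    using R(2) LF rpF rmF r0F by (auto simp: R'_def L_def)
  define N where "N = normal_closure ?F R'"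
  interpret N: normal N ?F unfolding N_def by (rule F.normal_closure_normal[OF R'])
  have R'N: "R' \<subseteq> N" by (simp add: N_def normal_closure_incl)
  have "R' \<subseteq> kernel ?F G \<phi>"
  proof -
    have "r \<in> kernel ?F G \<phi>" if "r \<in> R" for r
    proof -
      have "\<pi> r = \<one>" "r \<in> L"
        using that ker normal_closure_incl[of R ?L] R(2) by (auto simp: kernel_def L_def)
      then show ?thesis using LF by (auto simp: kernel_def \<phi>L)
    qed
    moreover have "rp i \<in> kernel ?F G \<phi>" "rm i \<in> kernel ?F G \<phi>" if i: "i < n" for i
    proof -
      have c: "\<pi> [(i, True)] \<in> carrier G" using K.mem_carrier[OF \<pi>K[OF xL[OF i]]] .
      have v: "\<phi> [(i, True)] = \<pi> [(i, True)]" "\<phi> (wp i) = t \<otimes> \<pi> [(i, True)] \<otimes> inv t"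
        "\<phi> (wm i) = inv t \<otimes> \<pi> [(i, True)] \<otimes> t"
        using xL[OF i] wp[OF i] wm[OF i] by (simp_all add: \<phi>L)
      have "\<phi> (rp i) = t \<otimes> \<pi> [(i, True)] \<otimes> inv t \<otimes> inv (t \<otimes> \<pi> [(i, True)] \<otimes> inv t)"
        using xF(1)[OF i] wF[OF i] y by (simp add: rp_def \<phi>y v del: inv_mult_group)
      moreover have "\<phi> (rm i) = inv t \<otimes> \<pi> [(i, True)] \<otimes> t \<otimes> inv (inv t \<otimes> \<pi> [(i, True)] \<otimes> t)"
        using xF(1)[OF i] wF[OF i] y by (simp add: rm_def \<phi>y v del: inv_mult_group)
      ultimately have "\<phi> (rp i) = \<one>" "\<phi> (rm i) = \<one>"
        using c t by (metis m_closed inv_closed r_inv)+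
      then show "rp i \<in> kernel ?F G \<phi>" "rm i \<in> kernel ?F G \<phi>"
        using rpF[OF i] rmF[OF i] by (simp_all add: kernel_def)
    qed
    moreover have "r0 \<in> kernel ?F G \<phi>"
      using r0F w0F y t \<phi>L[OF w0(1)] w0(2) by (simp add: kernel_def r0_def \<phi>y \<phi>.hom_int_pow)
    ultimately show ?thesis by (auto simp: R'_def)
  qed
  then have N_ker: "N \<subseteq> kernel ?F G \<phi>"
    unfolding N_def by (rule normal_closure_minimal[OF \<phi>.normal_kernel])
  \<comment> \<open>Modulo the relators \<open>P\<close> is the image of \<open>L\<close>, the
    candidate for a copy of \<open>K\<close>. Once it is known to be normal and to contain the
    \<open>m\<close>-th power of the new letter, every word can be collected as an element of
    \<open>P\<close> times a power of that letter.\<close>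
  define P where "P = N <#>\<^bsub>?F\<^esub> L"
  have Psub: "subgroup P ?F"
    unfolding P_def by (rule F.normal_set_mult_subgroup[OF N.normal_axioms Lsub])
  interpret P: subgroup P ?F by (rule Psub)
  have PI: "w \<in> P" if "w \<otimes>\<^bsub>?F\<^esub> inv\<^bsub>?F\<^esub> u \<in> N" "u \<in> L" "w \<in> carrier ?F" for w u
  proof -
    have "w = (w \<otimes>\<^bsub>?F\<^esub> inv\<^bsub>?F\<^esub> u) \<otimes>\<^bsub>?F\<^esub> u" using that LF by (simp add: F.m_assoc)
    then show ?thesis using that unfolding P_def set_mult_def by blast
  qed
  have NP: "N \<subseteq> P"
  proof
    fix w assume w: "w \<in> N"
    show "w \<in> P" by (rule PI[of w "\<one>\<^bsub>?F\<^esub>"]) (use w in auto)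
  qed
  have LP: "L \<subseteq> P"
  proof
    fix w assume w: "w \<in> L"
    show "w \<in> P" by (rule PI[of w w]) (use w in auto)
  qed
  have conjP: "z \<otimes>\<^bsub>?F\<^esub> p \<otimes>\<^bsub>?F\<^esub> inv\<^bsub>?F\<^esub> z \<in> P"
    if z: "z \<in> carrier ?F" and p: "p \<in> P"
      and gen: "\<And>i. i < n \<Longrightarrow> z \<otimes>\<^bsub>?F\<^esub> [(i, True)] \<otimes>\<^bsub>?F\<^esub> inv\<^bsub>?F\<^esub> z \<in> P" for z p
  proof -
    have conj_L: "z \<otimes>\<^bsub>?F\<^esub> u \<otimes>\<^bsub>?F\<^esub> inv\<^bsub>?F\<^esub> z \<in> P" if "u \<in> L" for u
      using that unfolding genL[symmetric]
    proof (induction u rule: generate.induct)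
      case one
      then show ?case using z by simp
    next
      case (incl s)
      then show ?case using gen by auto
    next
      case (inv s)
      then have s: "s \<in> carrier ?F" using xF by auto
      have "inv\<^bsub>?F\<^esub> (z \<otimes>\<^bsub>?F\<^esub> s \<otimes>\<^bsub>?F\<^esub> inv\<^bsub>?F\<^esub> z) \<in> P" using inv gen by auto
      then show ?case using z s by (simp add: F.inv_mult_group F.m_assoc)
    next
      case (eng u v)
      then have uv: "u \<in> carrier ?F" "v \<in> carrier ?F" using LF genL by auto
      have "(z \<otimes>\<^bsub>?F\<^esub> u \<otimes>\<^bsub>?F\<^esub> inv\<^bsub>?F\<^esub> z) \<otimes>\<^bsub>?F\<^esub> (z \<otimes>\<^bsub>?F\<^esub> v \<otimes>\<^bsub>?F\<^esub> inv\<^bsub>?F\<^esub> z) \<in> P"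
        using eng by blast
      then show ?case using z uv by (simp add: F.m_assoc F.mult_inv_mult_cancel)
    qed
    obtain v u where p': "v \<in> N" "u \<in> L" "p = v \<otimes>\<^bsub>?F\<^esub> u"
      using p by (auto simp: P_def set_mult_def)
    have "(z \<otimes>\<^bsub>?F\<^esub> v \<otimes>\<^bsub>?F\<^esub> inv\<^bsub>?F\<^esub> z) \<otimes>\<^bsub>?F\<^esub> (z \<otimes>\<^bsub>?F\<^esub> u \<otimes>\<^bsub>?F\<^esub> inv\<^bsub>?F\<^esub> z) \<in> P"
      using N.inv_op_closed2[OF z p'(1)] NP conj_L[OF p'(2)] by blast
    then show ?thesis using p' z LF by (simp add: F.m_assoc F.mult_inv_mult_cancel)
  qed
  let ?SF = "(\<lambda>i. [(i, True)]) ` {..<Suc n}"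
  have SF: "?SF = insert ?y ?SL" by (auto simp: lessThan_Suc)
  have "P \<lhd> ?F"
  proof (rule F.normal_if_normalized_by_generators[OF Psub])
    show "?SF \<subseteq> carrier ?F" by (auto simp: free_generator_closed)
    show "generate ?F ?SF = carrier ?F" by (rule free_group_generated)
    fix s p assume s: "s \<in> ?SF" and p: "p \<in> P"
    show "s \<otimes>\<^bsub>?F\<^esub> p \<otimes>\<^bsub>?F\<^esub> inv\<^bsub>?F\<^esub> s \<in> P \<and> inv\<^bsub>?F\<^esub> s \<otimes>\<^bsub>?F\<^esub> p \<otimes>\<^bsub>?F\<^esub> s \<in> P"
    proof (cases "s = ?y")
      case True
      \<comment> \<open>The conjugation relators say that these conjugates agree modulo
        \<open>N\<close> with words in \<open>L\<close>.\<close>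
      have "?y \<otimes>\<^bsub>?F\<^esub> [(i, True)] \<otimes>\<^bsub>?F\<^esub> inv\<^bsub>?F\<^esub> ?y \<in> P" if "i < n" for i
        by (rule PI[of _ "wp i"]) (use that R'N wp(1) xF y in \<open>auto simp: R'_def rp_def\<close>)
      moreover have "inv\<^bsub>?F\<^esub> ?y \<otimes>\<^bsub>?F\<^esub> [(i, True)] \<otimes>\<^bsub>?F\<^esub> ?y \<in> P" if "i < n" for i
        by (rule PI[of _ "wm i"]) (use that R'N wm(1) xF y in \<open>auto simp: R'_def rm_def\<close>)
      ultimately show ?thesis
        using conjP[OF y p] conjP[of "inv\<^bsub>?F\<^esub> ?y" p] y p True by simp
    next
      case False
      then have "s \<in> P" using s SF SL LP by auto
      then show ?thesis using p by simp
    qed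
  qed
  have "?y [^]\<^bsub>?F\<^esub> m \<in> P"
    by (rule PI[of _ w0]) (use R'N w0 y in \<open>auto simp: R'_def r0_def\<close>)
  \<comment> \<open>Collect \<open>w\<close> as \<open>p\<close> times the \<open>k\<close>-th power
    of the new letter. As \<open>\<phi>\<close> maps \<open>P\<close> into \<open>K\<close>,
    triviality of \<open>\<phi> w\<close> puts \<open>t [^] k\<close> into \<open>K\<close>; so
    \<open>m dvd k\<close> and \<open>w\<close> lies in \<open>P\<close>. Up to a factor in
    \<open>N\<close> this leaves a word in \<open>L\<close>, where the presentation of
    \<open>K\<close> applies.\<close>
  have "w \<in> N" if w: "w \<in> kernel ?F G \<phi>" for w
  proof -
    have wF: "w \<in> carrier ?F" and w1: "\<phi> w = \<one>" using w by (auto simp: kernel_def)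
    have \<phi>P: "\<phi> p \<in> K" if "p \<in> P" for p
    proof -
      obtain v u where p': "v \<in> N" "u \<in> L" "p = v \<otimes>\<^bsub>?F\<^esub> u"
        using \<open>p \<in> P\<close> by (auto simp: P_def set_mult_def)
      have "\<phi> v = \<one>" using p' N_ker by (auto simp: kernel_def)
      then show ?thesis using p' LF \<pi>K by (auto simp: \<phi>L)
    qed
    have "?SF \<subseteq> insert ?y P"
      unfolding SF using subset_trans[OF SL LP] by (rule insert_mono)
    from F.generated_mod_normal_cyclic[OF \<open>P \<lhd> ?F\<close> y this free_group_generated wF]
    obtain p k where pk: "p \<in> P" "w = p \<otimes>\<^bsub>?F\<^esub> ?y [^]\<^bsub>?F\<^esub> (k::int)"
      by (elim bexE exE)
    have "\<phi> p \<otimes> t [^] k = \<one>"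
      using w1 pk y by (simp add: \<phi>.hom_int_pow \<phi>y)
    then have "inv (t [^] k) = \<phi> p"
      using \<phi>P[OF pk(1)] t by (intro inv_equality) auto
    then have "inv (inv (t [^] k)) \<in> K" using \<phi>P[OF pk(1)] by simp
    then have "t [^] k \<in> K" using t by simp
    then obtain j where "k = m * j" using m(2) by (auto simp: dvd_def)
    then have "?y [^]\<^bsub>?F\<^esub> k \<in> P"
      using F.subgroup_int_pow_closed[OF Psub \<open>?y [^]\<^bsub>?F\<^esub> m \<in> P\<close>, of j] y
      by (simp add: F.int_pow_pow)
    then have "w \<in> P" using pk by simp
    then obtain v u where vu: "v \<in> N" "u \<in> L" "w = v \<otimes>\<^bsub>?F\<^esub> u"
      by (auto simp: P_def set_mult_def)
    have "\<phi> v = \<one>" using vu N_ker by (auto simp: kernel_def)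
    then have "\<pi> u = \<one>" using w1 vu LF \<pi>K by (auto simp: \<phi>L)
    then have "u \<in> kernel ?L (G\<lparr>carrier := K\<rparr>) \<pi>" using vu by (simp add: kernel_def L_def)
    then have "u \<in> normal_closure ?L R" using ker by simp
    moreover have "normal_closure ?L R \<subseteq> N \<inter> L"
      using F.normal_Int_subgroup[OF Lsub N.normal_axioms, unfolded FL] R(2) R'N
      by (intro normal_closure_minimal) (auto simp: L_def R'_def)
    ultimately show ?thesis using vu by blast
  qed
  then have "kernel ?F G \<phi> = N" using N_ker by blast
  moreover have "\<phi> ` carrier ?F = carrier G"
  proof
    show "\<phi> ` carrier ?F \<subseteq> carrier G" by auto
    show "carrier G \<subseteq> \<phi> ` carrier ?F"
    proof
      fix g assume "g \<in> carrier G"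
      then obtain k j where g: "k \<in> K" "g = k \<otimes> t [^] (j::int)" using cyc by blast
      obtain u where "u \<in> L" "\<pi> u = k" using lift[OF g(1)] by blast
      then have "g = \<phi> (u \<otimes>\<^bsub>?F\<^esub> ?y [^]\<^bsub>?F\<^esub> j)" "u \<otimes>\<^bsub>?F\<^esub> ?y [^]\<^bsub>?F\<^esub> j \<in> carrier ?F"
        using g LF y by (auto simp: \<phi>L \<phi>y \<phi>.hom_int_pow)
      then show "g \<in> \<phi> ` carrier ?F" by blast
    qed
  qed
  moreover have "finite R'" using R by (simp add: R'_def)
  ultimately show ?thesis
    using R' \<phi>.homh by (intro finitely_presentedI[of R' "Suc n" \<phi>]) (simp_all add: N_def)
qed

end

text \<open>Induction along the series; at each step a representative of a generator of the cyclic
  quotient serves as \<open>t\<close>.\<close>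

theorem (in group) polycyclic_imp_finitely_presented:
  assumes "polycyclic G"
  shows "finitely_presented G"
proof -
  have "finitely_presented (G\<lparr>carrier := H\<rparr>)" if "polycyclic_seq G H" for H
    using that
  proof (induction rule: polycyclic_seq.induct)
    case unity
    then show ?case by (rule finitely_presented_trivial)
  next
    case (extension K H)
    let ?H = "G\<lparr>carrier := H\<rparr>"
    interpret H: group ?H by (rule subgroup_imp_group[OF extension(3)])
    interpret K: normal K ?H by (rule extension(2))
    interpret Q: group "?H Mod K" by (rule K.factorgroup_is_group)
    obtain x where x: "x \<in> carrier (?H Mod K)"
      "carrier (?H Mod K) = range (\<lambda>n::int. x [^]\<^bsub>?H Mod K\<^esub> n)"
      using extension(4) Q.cyclic_group by blast
    then obtain t where t: "t \<in> carrier ?H" "x = K #>\<^bsub>?H\<^esub> t"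
      unfolding carrier_FactGroup by blast
    show ?case
    proof (rule H.finitely_presented_cyclic_extension[OF extension(2) _ t(1)])
      show "finitely_presented (?H\<lparr>carrier := K\<rparr>)" using extension.IH by simp
      fix g assume g: "g \<in> carrier ?H"
      then have "K #>\<^bsub>?H\<^esub> g \<in> carrier (?H Mod K)" by (simp add: carrier_FactGroup)
      then obtain n :: int where "K #>\<^bsub>?H\<^esub> g = x [^]\<^bsub>?H Mod K\<^esub> n" using x(2) by auto
      then have "K #>\<^bsub>?H\<^esub> g = K #>\<^bsub>?H\<^esub> (t [^]\<^bsub>?H\<^esub> n)"
        using t K.FactGroup_int_pow by metis
      then have "g \<in> K #>\<^bsub>?H\<^esub> (t [^]\<^bsub>?H\<^esub> n)"
        using H.rcos_self[OF g K.subgroup_axioms] by blast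
      then show "\<exists>k\<in>K. \<exists>n::int. g = k \<otimes>\<^bsub>?H\<^esub> t [^]\<^bsub>?H\<^esub> n"
        unfolding r_coset_def by blast
    qed
  qed
  from this[of "carrier G"] show ?thesis
    using assms by (simp add: polycyclic_def)
qed

section \<open>Finitely generated abelian-by-abelian groups\<close>

context comm_group
begin

text \<open>Induction on the generators. The exponents of \<open>s\<close> that occur in elements of
  \<open>H\<close>, modulo \<open>generate G S\<close>, are the multiples of some \<open>d\<close>.
  An element \<open>?h\<close> of \<open>H\<close> realizing \<open>d\<close>, together with
  generators of \<open>H \<inter> generate G S\<close>, suffices: dividing by a power of
  \<open>?h\<close> removes \<open>s\<close>.\<close>

lemma subgroup_of_finitely_generated:
  assumes "finite S" "S \<subseteq> carrier G" "subgroup H G" "H \<subseteq> generate G S"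
  shows "\<exists>T. finite T \<and> T \<subseteq> H \<and> generate G T = H"
  using assms
proof (induction S arbitrary: H rule: finite_induct)
  case empty
  then have "H = {\<one>}"
    using subgroup.one_closed[of H G] by (auto simp: generate_empty)
  then show ?case by (intro exI[of _ "{}"]) (simp add: generate_empty)
next
  case (insert s S)
  interpret H: subgroup H G by (rule insert.prems)
  have s: "s \<in> carrier G" and S: "S \<subseteq> carrier G" using insert.prems by auto
  interpret S: subgroup "generate G S" G by (rule generate_is_subgroup[OF S])
  have split: "\<exists>u \<in> generate G S. \<exists>k::int. x = u \<otimes> s [^] k" if "x \<in> H" for x
  proof -
    let ?M = "generate G S <#> generate G {s}"
    have "subgroup ?M G"
      by (intro mult_subgroups S.subgroup_axioms generate_is_subgroup) (use s in simp)
    moreover have M: "x \<otimes> y \<in> ?M" if "x \<in> generate G S" "y \<in> generate G {s}" for x y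
      using that unfolding set_mult_def by blast
    moreover have "s \<in> ?M"
      using M[OF S.one_closed, of s] s by (simp add: generate.incl)
    moreover have "S \<subseteq> ?M"
      using M[OF generate.incl generate.one] S by (metis r_one subset_iff)
    ultimately have "generate G (insert s S) \<subseteq> ?M"
      by (intro generate_subgroup_incl) auto
    then have "x \<in> ?M" using that insert.prems by blast
    then show ?thesis by (auto simp: set_mult_def generate_pow[OF s])
  qed
  let ?J = "{k::int. \<exists>u \<in> generate G S. u \<otimes> s [^] k \<in> H}"
  obtain d where "d \<in> ?J" and d: "\<And>k. k \<in> ?J \<Longrightarrow> d dvd k"
  proof (rule int_subgroup_principal[of ?J])
    show "0 \<in> ?J" using S.one_closed H.one_closed by (auto intro: bexI[of _ \<one>])
    fix k l assume "k \<in> ?J" "l \<in> ?J"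
    then obtain u v where uv: "u \<in> generate G S" "u \<otimes> s [^] k \<in> H" "v \<in> generate G S" "v \<otimes> s [^] l \<in> H"
      by blast
    have "(u \<otimes> inv v) \<otimes> s [^] (k - l) = (u \<otimes> s [^] k) \<otimes> inv (v \<otimes> s [^] l)"
      using uv s by (simp add: int_pow_diff inv_mult m_ac)
    then have "(u \<otimes> inv v) \<otimes> s [^] (k - l) \<in> H" using uv by simp
    moreover have "u \<otimes> inv v \<in> generate G S" using uv by simp
    ultimately show "k - l \<in> ?J" by blast
  qed (rule that)
  then obtain u0 where u0: "u0 \<in> generate G S" "u0 \<otimes> s [^] d \<in> H" by blast
  let ?h = "u0 \<otimes> s [^] d"
  obtain T where T: "finite T" "T \<subseteq> H \<inter> generate G S" "generate G T = H \<inter> generate G S"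
    using insert.IH[OF S subgroups_Inter_pair[OF H.subgroup_axioms S.subgroup_axioms]] by auto
  have hT: "insert ?h T \<subseteq> H" using T u0 by auto
  then interpret hT: subgroup "generate G (insert ?h T)" G
    by (intro generate_is_subgroup) (use H.subset in blast)
  have "generate G (insert ?h T) = H"
  proof
    show "generate G (insert ?h T) \<subseteq> H"
      by (rule generate_subgroup_incl[OF hT H.subgroup_axioms])
    show "H \<subseteq> generate G (insert ?h T)"
    proof
      fix x assume x: "x \<in> H"
      then obtain u k where u: "u \<in> generate G S" "x = u \<otimes> s [^] (k::int)" using split by blast
      then have "d dvd k" using x by (intro d) blast
      then obtain j where j: "k = d * j" by (auto simp: dvd_def)
      have h: "?h [^] j \<in> H" by (rule subgroup_int_pow_closed[OF H.subgroup_axioms u0(2)])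
      have u0j: "u0 [^] j \<in> generate G S"
        by (rule subgroup_int_pow_closed[OF S.subgroup_axioms u0(1)])
      have hj: "?h [^] j = u0 [^] j \<otimes> s [^] k"
        using u0(1) s by (simp add: int_pow_distrib int_pow_pow j)
      have eq: "x \<otimes> inv (?h [^] j) = u \<otimes> inv (u0 [^] j)"
        using u u0j s unfolding hj by (simp add: inv_mult m_ac mult_inv_mult_cancel)
      then have "x \<otimes> inv (?h [^] j) \<in> H \<inter> generate G S"
        using x h u u0j by (metis IntI H.m_closed H.m_inv_closed S.m_closed S.m_inv_closed)
      then have "x \<otimes> inv (?h [^] j) \<in> generate G (insert ?h T)"
        using T mono_generate[of T "insert ?h T"] by blast
      moreover have "?h [^] j \<in> generate G (insert ?h T)"
        by (rule subgroup_int_pow_closed[OF hT.subgroup_axioms]) (simp add: generate.incl)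
      ultimately have "x \<otimes> inv (?h [^] j) \<otimes> ?h [^] j \<in> generate G (insert ?h T)" by simp
      then show "x \<in> generate G (insert ?h T)"
        using x h by (simp add: m_assoc)
    qed
  qed
  then show ?case using hT T by (intro exI[of _ "insert ?h T"]) auto
qed

text \<open>The ascending chain condition in the form used for integrality: the subgroup spanned by
  the whole sequence has finitely many generators, and these already lie in the span of an initial
  segment.\<close>

lemma finitely_generated_sequence_dependent:
  fixes v :: "nat \<Rightarrow> 'a"
  assumes S: "finite S" "S \<subseteq> carrier G" and v: "\<And>i. v i \<in> generate G S"
  shows "\<exists>m. v m \<in> generate G (v ` {..<m})"
proof -
  have v_carrier: "range v \<subseteq> carrier G" using v generate_in_carrier[OF S(2)] by blast
  have "generate G (range v) \<subseteq> generate G S"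
    using v by (intro generate_subgroup_incl generate_is_subgroup S) auto
  then obtain T where T: "finite T" "T \<subseteq> generate G (range v)" "generate G T = generate G (range v)"
    using subgroup_of_finitely_generated[OF S generate_is_subgroup[OF v_carrier]] by blast
  have mono: "generate G (v ` {..<k}) \<subseteq> generate G (v ` {..<l})" if "k \<le> l" for k l
    using that by (intro mono_generate image_mono) auto
  have bounded: "\<exists>m. x \<in> generate G (v ` {..<m})" if "x \<in> generate G (range v)" for x
    using that
  proof (induction x rule: generate.induct)
    case one
    then show ?case using generate.one by blast
  next
    case (incl x)
    then obtain i where "x = v i" by blast
    then show ?case by (intro exI[of _ "Suc i"]) (auto intro: generate.incl)
  next
    case (inv x)
    then obtain i where "x = v i" by blast
    then show ?case by (intro exI[of _ "Suc i"]) (auto intro: generate.inv)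
  next
    case (eng x y)
    then obtain k l where "x \<in> generate G (v ` {..<k})" "y \<in> generate G (v ` {..<l})" by blast
    then have "x \<in> generate G (v ` {..<max k l})" "y \<in> generate G (v ` {..<max k l})"
      using mono[of k "max k l"] mono[of l "max k l"] by auto
    then show ?case by (blast intro: generate.eng)
  qed
  have "\<exists>m. T' \<subseteq> generate G (v ` {..<m})" if "finite T'" "T' \<subseteq> T" for T'
    using that
  proof (induction T' rule: finite_induct)
    case (insert x T')
    then obtain k l where "T' \<subseteq> generate G (v ` {..<k})" "x \<in> generate G (v ` {..<l})"
      using bounded T(2) by blast
    then show ?case
      using mono[of k "max k l"] mono[of l "max k l"] by (intro exI[of _ "max k l"]) auto
  qed simp
  then obtain m where m: "T \<subseteq> generate G (v ` {..<m})" using T by blast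
  have "generate G T \<subseteq> generate G (v ` {..<m})"
    using m v_carrier by (intro generate_subgroup_incl generate_is_subgroup) auto
  moreover have "v m \<in> generate G T" using T by (auto intro: generate.incl)
  ultimately show ?thesis by blast
qed

end

section \<open>Construction of polycyclic series\<close>

context group
begin

lemma polycyclic_seq_adjoin:
  assumes K: "polycyclic_seq G K" and s: "s \<in> carrier G"
    and norm: "\<And>p. p \<in> K \<Longrightarrow> s \<otimes> p \<otimes> inv s \<in> K \<and> inv s \<otimes> p \<otimes> s \<in> K"
  shows "polycyclic_seq G (generate G (insert s K))"
proof -
  have Ksub: "subgroup K G" by (rule polycyclic_seq_subgroup[OF K])
  interpret K: subgroup K G by (rule Ksub)
  let ?S = "insert s K"
  define H where "H = generate G ?S"
  have Hsub: "subgroup H G"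
    unfolding H_def by (rule generate_is_subgroup) (use s K.subset in blast)
  interpret H: subgroup H G by (rule Hsub)
  let ?H = "G\<lparr>carrier := H\<rparr>"
  interpret GH: group ?H by (rule subgroup_imp_group[OF Hsub])
  have SH: "?S \<subseteq> H" by (auto simp: H_def intro: generate.incl)
  then have sH: "s \<in> H" and KH: "K \<subseteq> H" by auto
  have gen: "generate ?H ?S = carrier ?H"
    using generate_consistent[OF SH Hsub] by (simp add: H_def)
  have "K \<lhd> ?H"
  proof (rule GH.normal_if_normalized_by_generators[OF _ _ gen])
    show "subgroup K ?H"
      using GH.group_incl_imp_subgroup[of K] KH subgroup_imp_group[OF Ksub] by simp
    show "?S \<subseteq> carrier ?H" using SH by simp
    fix g p assume "g \<in> ?S" "p \<in> K"
    moreover from this have "inv\<^bsub>?H\<^esub> g = inv g"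
      using m_inv_consistent[OF Hsub] SH by blast
    ultimately show "g \<otimes>\<^bsub>?H\<^esub> p \<otimes>\<^bsub>?H\<^esub> inv\<^bsub>?H\<^esub> g \<in> K \<and> inv\<^bsub>?H\<^esub> g \<otimes>\<^bsub>?H\<^esub> p \<otimes>\<^bsub>?H\<^esub> g \<in> K"
      using norm by auto
  qed
  interpret N: normal K ?H by fact
  interpret Q: group "?H Mod K" by (rule N.factorgroup_is_group)
  let ?x = "K #>\<^bsub>?H\<^esub> s"
  have x: "?x \<in> carrier (?H Mod K)"
    using sH unfolding carrier_FactGroup by (intro imageI) simp
  have "carrier (?H Mod K) \<subseteq> range (\<lambda>n::int. ?x [^]\<^bsub>?H Mod K\<^esub> n)"
  proof
    fix X assume "X \<in> carrier (?H Mod K)"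
    then obtain g where g: "g \<in> carrier ?H" "X = K #>\<^bsub>?H\<^esub> g" unfolding carrier_FactGroup by blast
    from GH.generated_mod_normal_cyclic[OF \<open>K \<lhd> ?H\<close> _ _ gen g(1), of s] sH
    obtain p k where pk: "p \<in> K" "g = p \<otimes>\<^bsub>?H\<^esub> s [^]\<^bsub>?H\<^esub> (k::int)" by auto
    have sk: "s [^]\<^bsub>?H\<^esub> k \<in> carrier ?H" by (rule GH.int_pow_closed) (use sH in simp)
    have "K #>\<^bsub>?H\<^esub> g = K #>\<^bsub>?H\<^esub> (s [^]\<^bsub>?H\<^esub> k)"
      using GH.coset_mult_assoc[OF N.subset _ sk, of p] GH.coset_join2[OF _ N.subgroup_axioms pk(1)]
        pk N.subset by auto
    then have "X = ?x [^]\<^bsub>?H Mod K\<^esub> k"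
      using g N.FactGroup_int_pow[of s k] sH by simp
    then show "X \<in> range (\<lambda>n::int. ?x [^]\<^bsub>?H Mod K\<^esub> n)" by blast
  qed
  moreover have "range (\<lambda>n::int. ?x [^]\<^bsub>?H Mod K\<^esub> n) \<subseteq> carrier (?H Mod K)"
    by (rule image_subsetI) (rule Q.int_pow_closed[OF x])
  ultimately have "carrier (?H Mod K) = range (\<lambda>n::int. ?x [^]\<^bsub>?H Mod K\<^esub> n)"
    by (rule equalityI)
  then have "cyclic_group (?H Mod K)"
    unfolding Q.cyclic_group by (rule bexI[OF _ x])
  from polycyclic_seq.extension[OF K \<open>K \<lhd> ?H\<close> Hsub this] show ?thesis
    by (simp only: H_def)
qed

lemma generate_insert_generate:
  assumes "insert s S \<subseteq> carrier G"
  shows "generate G (insert s (generate G S)) = generate G (insert s S)"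
proof
  have "generate G S \<subseteq> generate G (insert s S)"
    by (rule mono_generate) auto
  then show "generate G (insert s (generate G S)) \<subseteq> generate G (insert s S)"
    using assms by (intro generate_subgroup_incl generate_is_subgroup) (auto intro: generate.incl)
  show "generate G (insert s S) \<subseteq> generate G (insert s (generate G S))"
    by (rule mono_generate) (auto intro: generate.incl)
qed

text \<open>Every intermediate group contains all commutators of the full one, hence is normalized
  by it. The elements of \<open>S\<close> can thus be adjoined one at a time, each giving a cyclic
  step.\<close>

lemma polycyclic_seq_adjoin_finite:
  assumes K: "polycyclic_seq G K" and S: "finite S" "S \<subseteq> carrier G"
    and comm: "\<And>g h. g \<in> generate G (K \<union> S) \<Longrightarrow> h \<in> generate G (K \<union> S) \<Longrightarrow>
      g \<otimes> h \<otimes> inv g \<otimes> inv h \<in> K"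
  shows "polycyclic_seq G (generate G (K \<union> S))"
proof -
  have Ksub: "subgroup K G" by (rule polycyclic_seq_subgroup[OF K])
  interpret K: subgroup K G by (rule Ksub)
  have KS: "K \<union> S \<subseteq> carrier G" using K.subset S by blast
  interpret KS: subgroup "generate G (K \<union> S)" G by (rule generate_is_subgroup[OF KS])
  have "polycyclic_seq G (generate G (K \<union> T))" if "finite T" "T \<subseteq> S" for T
    using that
  proof (induction T rule: finite_induct)
    case empty
    have "generate G K = K"
      using generate_subgroup_incl[OF _ Ksub, of K] by (auto intro: generate.incl)
    then show ?case using K by simp
  next
    case (insert s T)
    let ?P = "generate G (K \<union> T)"
    interpret P: subgroup ?P G by (rule generate_is_subgroup) (use KS insert.prems in blast)
    have PS: "?P \<subseteq> generate G (K \<union> S)" by (rule mono_generate) (use insert.prems in blast)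
    have KP: "K \<subseteq> ?P" by (auto intro: generate.incl)
    have sS: "s \<in> generate G (K \<union> S)" using insert.prems by (auto intro: generate.incl)
    have s: "s \<in> carrier G" using S insert.prems by blast
    have conj: "g \<otimes> p \<otimes> inv g \<in> ?P" if "g \<in> generate G (K \<union> S)" "p \<in> ?P" for g p
    proof -
      have "g \<otimes> p \<otimes> inv g \<otimes> inv p \<in> ?P" using comm[of g p] that PS KP by blast
      then have "g \<otimes> p \<otimes> inv g \<otimes> inv p \<otimes> p \<in> ?P" using that by simp
      then show ?thesis using that by (simp add: m_assoc)
    qed
    have "polycyclic_seq G (generate G (insert s ?P))"
    proof (rule polycyclic_seq_adjoin[OF _ s])
      show "polycyclic_seq G ?P" using insert by simp
      show "s \<otimes> p \<otimes> inv s \<in> ?P \<and> inv s \<otimes> p \<otimes> s \<in> ?P" if "p \<in> ?P" for p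
        using conj[OF sS that] conj[OF KS.m_inv_closed[OF sS] that] s by simp
    qed
    moreover have "generate G (insert s ?P) = generate G (K \<union> insert s T)"
      using generate_insert_generate[of s "K \<union> T"] KS insert.prems by auto
    ultimately show ?case by simp
  qed
  then show ?thesis using S by blast
qed

text \<open>The series is built in two stages: from the trivial group to
  \<open>generate G T\<close>, where commutators vanish, and from there to \<open>G\<close>, whose
  commutators lie in \<open>generate G T\<close>.\<close>

theorem polycyclic_if_abelian_by_abelian:
  assumes S: "finite S" "S \<subseteq> carrier G" "generate G S = carrier G"
    and T: "finite T" "T \<subseteq> carrier G"
    and comm: "\<And>a b. a \<in> generate G T \<Longrightarrow> b \<in> generate G T \<Longrightarrow> a \<otimes> b = b \<otimes> a"
    and derived: "\<And>g h. g \<in> carrier G \<Longrightarrow> h \<in> carrier G \<Longrightarrow> g \<otimes> h \<otimes> inv g \<otimes> inv h \<in> generate G T"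
  shows "polycyclic G"
proof -
  let ?A = "generate G T"
  interpret A: subgroup ?A G by (rule generate_is_subgroup[OF T(2)])
  have eq: "generate G ({\<one>} \<union> T) = ?A"
    using mono_generate[of T "{\<one>} \<union> T"] A.one_closed
      generate_subgroup_incl[OF _ A.subgroup_axioms, of "{\<one>} \<union> T"]
    by (auto intro: generate.incl)
  have "polycyclic_seq G (generate G ({\<one>} \<union> T))"
  proof (rule polycyclic_seq_adjoin_finite[OF polycyclic_seq.unity T])
    fix g h assume gh: "g \<in> generate G ({\<one>} \<union> T)" "h \<in> generate G ({\<one>} \<union> T)"
    then have "g \<otimes> h = h \<otimes> g" "g \<in> carrier G" "h \<in> carrier G"
      using comm A.mem_carrier unfolding eq by auto
    then have "g \<otimes> h \<otimes> inv g \<otimes> inv h = \<one>" by (simp add: m_assoc mult_inv_mult_cancel)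
    then show "g \<otimes> h \<otimes> inv g \<otimes> inv h \<in> {\<one>}" by simp
  qed
  then have A: "polycyclic_seq G ?A" by (simp only: eq)
  have "generate G S \<subseteq> generate G (?A \<union> S)" by (rule mono_generate) simp
  then have G: "generate G (?A \<union> S) = carrier G"
    using generate_incl[of "?A \<union> S"] S A.subset by auto
  have "polycyclic_seq G (generate G (?A \<union> S))"
    by (rule polycyclic_seq_adjoin_finite[OF A S(1,2)]) (use derived G in auto)
  then show ?thesis unfolding polycyclic_def G .
qed

end

section \<open>The module structure of an abelian normal subgroup with abelian quotient\<close>

lemma (in group) generate_commute:
  assumes "x \<in> carrier G" "S \<subseteq> carrier G" "\<And>s. s \<in> S \<Longrightarrow> x \<otimes> s = s \<otimes> x" "g \<in> generate G S"
  shows "x \<otimes> g = g \<otimes> x"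
  using assms(4)
proof (induction g rule: generate.induct)
  case (inv s)
  then have s: "s \<in> carrier G" "x \<otimes> s = s \<otimes> x" using assms by auto
  have "x \<otimes> inv s = inv s \<otimes> (s \<otimes> x) \<otimes> inv s"
    using assms(1) s(1) by (simp add: m_assoc mult_inv_mult_cancel)
  also have "\<dots> = inv s \<otimes> x"
    using assms(1) s(1) by (simp add: s(2)[symmetric] m_assoc)
  finally show ?case .
next
  case (eng g h)
  then have c: "g \<in> carrier G" "h \<in> carrier G" using assms(2) generate_in_carrier by auto
  have "x \<otimes> (g \<otimes> h) = (g \<otimes> x) \<otimes> h"
    using eng(3) c assms(1) by (simp add: m_assoc[symmetric])
  also have "\<dots> = g \<otimes> (h \<otimes> x)"
    using eng(4) c assms(1) by (simp add: m_assoc)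
  finally show ?case using c assms(1) by (simp add: m_assoc)
qed (use assms in auto)

text \<open>The claim says that elements commute in \<open>G Mod N\<close>; there commutation
  spreads from generators to all elements, one argument at a time.\<close>

lemma (in group) commutators_in_normal:
  assumes N: "N \<lhd> G" and S: "S \<subseteq> carrier G" "generate G S = carrier G"
    and comm: "\<And>s t. s \<in> S \<Longrightarrow> t \<in> S \<Longrightarrow> s \<otimes> t \<otimes> inv s \<otimes> inv t \<in> N"
    and gh: "g \<in> carrier G" "h \<in> carrier G"
  shows "g \<otimes> h \<otimes> inv g \<otimes> inv h \<in> N"
proof -
  interpret N: normal N G by (rule N)
  interpret Q: group "G Mod N" by (rule N.factorgroup_is_group)
  let ?\<pi> = "\<lambda>g. N #> g"
  interpret \<pi>: group_hom G "G Mod N" ?\<pi> by unfold_locales (rule N.r_coset_hom_Mod)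
  have iff: "?\<pi> g \<otimes>\<^bsub>G Mod N\<^esub> ?\<pi> h = ?\<pi> h \<otimes>\<^bsub>G Mod N\<^esub> ?\<pi> g \<longleftrightarrow> g \<otimes> h \<otimes> inv g \<otimes> inv h \<in> N"
    if "g \<in> carrier G" "h \<in> carrier G" for g h
  proof -
    have "?\<pi> g \<otimes>\<^bsub>G Mod N\<^esub> ?\<pi> h = ?\<pi> h \<otimes>\<^bsub>G Mod N\<^esub> ?\<pi> g \<longleftrightarrow> N #> (g \<otimes> h) = N #> (h \<otimes> g)"
      by (simp only: \<pi>.hom_mult[OF that] \<pi>.hom_mult[OF that(2,1)])
    also have "\<dots> \<longleftrightarrow> g \<otimes> h \<in> N #> (h \<otimes> g)"
    proof
      assume "N #> (g \<otimes> h) = N #> (h \<otimes> g)"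
      moreover have "g \<otimes> h \<in> N #> (g \<otimes> h)"
        using that by (intro rcos_self N.subgroup_axioms) simp
      ultimately show "g \<otimes> h \<in> N #> (h \<otimes> g)" by simp
    next
      assume "g \<otimes> h \<in> N #> (h \<otimes> g)"
      from repr_independence[OF this _ N.subgroup_axioms]
      show "N #> (g \<otimes> h) = N #> (h \<otimes> g)" using that by simp
    qed
    also have "\<dots> \<longleftrightarrow> g \<otimes> h \<otimes> inv (h \<otimes> g) \<in> N"
      using that by (intro N.rcos_module) auto
    finally show ?thesis using that by (simp add: inv_mult_group m_assoc)
  qed
  have gen: "generate (G Mod N) (?\<pi> ` S) = carrier (G Mod N)"
    using \<pi>.generate_img[OF S(1)] by (simp add: S(2) carrier_FactGroup)
  have \<pi>S: "?\<pi> ` S \<subseteq> carrier (G Mod N)" using S(1) by (auto intro!: \<pi>.hom_closed)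
  have 1: "?\<pi> s \<otimes>\<^bsub>G Mod N\<^esub> x = x \<otimes>\<^bsub>G Mod N\<^esub> ?\<pi> s" if "s \<in> S" "x \<in> carrier (G Mod N)" for s x
  proof (rule Q.generate_commute[OF _ \<pi>S])
    show "?\<pi> s \<in> carrier (G Mod N)" using \<pi>S that by blast
    show "x \<in> generate (G Mod N) (?\<pi> ` S)" using that gen by simp
    show "?\<pi> s \<otimes>\<^bsub>G Mod N\<^esub> y = y \<otimes>\<^bsub>G Mod N\<^esub> ?\<pi> s" if "y \<in> ?\<pi> ` S" for y
      using that \<open>s \<in> S\<close> iff comm S(1) by blast
  qed
  have \<pi>gh: "?\<pi> g \<in> carrier (G Mod N)" "?\<pi> h \<in> carrier (G Mod N)" using gh by (auto intro!: \<pi>.hom_closed)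
  have "?\<pi> g \<otimes>\<^bsub>G Mod N\<^esub> ?\<pi> h = ?\<pi> h \<otimes>\<^bsub>G Mod N\<^esub> ?\<pi> g"
  proof (rule Q.generate_commute[OF \<pi>gh(1) \<pi>S])
    show "?\<pi> h \<in> generate (G Mod N) (?\<pi> ` S)" using \<pi>gh gen by simp
    show "?\<pi> g \<otimes>\<^bsub>G Mod N\<^esub> y = y \<otimes>\<^bsub>G Mod N\<^esub> ?\<pi> g" if "y \<in> ?\<pi> ` S" for y
    proof -
      from \<open>y \<in> ?\<pi> ` S\<close> obtain s where "s \<in> S" "y = ?\<pi> s" by blast
      then show ?thesis using 1[of s "?\<pi> g"] \<pi>gh by simp
    qed
  qed
  then show ?thesis using iff[OF gh] by simp
qed

section \<open>The commutative ring of operators on \<open>A\<close>\<close>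

locale abelian_by_abelian = group G + A: normal A G for G (structure) and A +
  assumes A_commute: "a \<in> A \<Longrightarrow> b \<in> A \<Longrightarrow> a \<otimes> b = b \<otimes> a"
    and commutator_in_A: "g \<in> carrier G \<Longrightarrow> h \<in> carrier G \<Longrightarrow> g \<otimes> h \<otimes> inv g \<otimes> inv h \<in> A"
begin

lemma A_lcommute: "a \<in> A \<Longrightarrow> b \<in> A \<Longrightarrow> c \<in> A \<Longrightarrow> a \<otimes> (b \<otimes> c) = b \<otimes> (a \<otimes> c)"
  using A_commute[of a b] by (simp add: m_assoc[symmetric])

lemma A_assoc: "a \<in> A \<Longrightarrow> b \<in> A \<Longrightarrow> c \<in> A \<Longrightarrow> a \<otimes> b \<otimes> c = a \<otimes> (b \<otimes> c)"
  by (simp add: m_assoc)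

lemma A_inv_mult: "a \<in> A \<Longrightarrow> b \<in> A \<Longrightarrow> inv (a \<otimes> b) = inv a \<otimes> inv b"
  by (simp add: inv_mult_group A_commute)

lemmas A_ac = A_assoc A_commute A_lcommute A_inv_mult

lemma comm_group_A: "comm_group (G\<lparr>carrier := A\<rparr>)"
  by (rule group.group_comm_groupI[OF subgroup_imp_group[OF A.subgroup_axioms]])
    (simp add: A_commute)

definition act :: "'a \<Rightarrow> 'a \<Rightarrow> 'a" where
  "act g a = g \<otimes> a \<otimes> inv g"

lemma act_closed [simp]: "g \<in> carrier G \<Longrightarrow> a \<in> A \<Longrightarrow> act g a \<in> A"
  by (simp add: act_def A.inv_op_closed2)

lemma act_mult:
  "\<lbrakk> g \<in> carrier G; a \<in> A; b \<in> A \<rbrakk> \<Longrightarrow> act g (a \<otimes> b) = act g a \<otimes> act g b"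
  by (simp add: act_def m_assoc mult_inv_mult_cancel)

lemma act_act:
  "\<lbrakk> g \<in> carrier G; h \<in> carrier G; a \<in> A \<rbrakk> \<Longrightarrow> act g (act h a) = act (g \<otimes> h) a"
  by (simp add: act_def m_assoc inv_mult_group)

lemma act_A [simp]: "a \<in> A \<Longrightarrow> b \<in> A \<Longrightarrow> act a b = b"
  by (simp add: act_def A_commute[of a b] m_assoc)

lemma act_inv_cancel [simp]:
  "g \<in> carrier G \<Longrightarrow> a \<in> A \<Longrightarrow> act (inv g) (act g a) = a"
  "g \<in> carrier G \<Longrightarrow> a \<in> A \<Longrightarrow> act g (act (inv g) a) = a"
  by (simp_all add: act_act)

text \<open>The products \<open>g h\<close> and \<open>h g\<close> differ by a commutator, which
  lies in \<open>A\<close> and so acts trivially. This is the source of commutativity of the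
  operators.\<close>

lemma act_commute:
  assumes "g \<in> carrier G" "h \<in> carrier G" "a \<in> A"
  shows "act g (act h a) = act h (act g a)"
proof -
  have "act (g \<otimes> h) a = act ((g \<otimes> h \<otimes> inv g \<otimes> inv h) \<otimes> (h \<otimes> g)) a"
    using assms by (simp add: m_assoc mult_inv_mult_cancel)
  also have "\<dots> = act (g \<otimes> h \<otimes> inv g \<otimes> inv h) (act (h \<otimes> g) a)"
    using assms by (simp add: act_act)
  also have "\<dots> = act (h \<otimes> g) a"
    using commutator_in_A[of g h] assms by simp
  finally show ?thesis using assms by (simp add: act_act)
qed

lemma act_inv: "g \<in> carrier G \<Longrightarrow> a \<in> A \<Longrightarrow> act g (inv a) = inv (act g a)"
  by (simp add: act_def inv_mult_group m_assoc)

text \<open>The image of the group ring of \<open>G / A\<close> in the endomorphism ring of \<open>A\<close>; the operators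
  are only meaningful on \<open>A\<close>.\<close>

inductive_set ops :: "('a \<Rightarrow> 'a) set" where
  ops_act: "g \<in> carrier G \<Longrightarrow> act g \<in> ops"
| ops_id: "(\<lambda>a. a) \<in> ops"
| ops_one: "(\<lambda>a. \<one>) \<in> ops"
| ops_times: "f \<in> ops \<Longrightarrow> h \<in> ops \<Longrightarrow> (\<lambda>a. f a \<otimes> h a) \<in> ops"
| ops_inverse: "f \<in> ops \<Longrightarrow> (\<lambda>a. inv (f a)) \<in> ops"
| ops_comp: "f \<in> ops \<Longrightarrow> h \<in> ops \<Longrightarrow> (\<lambda>a. f (h a)) \<in> ops"

text \<open>Normal subgroups of \<open>G\<close> inside \<open>A\<close> are submodules, so
  operators descend to the quotients by them.\<close>

lemma ops_preserves_normal:
  "f \<in> ops \<Longrightarrow> K \<lhd> G \<Longrightarrow> K \<subseteq> A \<Longrightarrow> a \<in> K \<Longrightarrow> f a \<in> K"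
proof (induction f arbitrary: a rule: ops.induct)
  case (ops_act g)
  then show ?case by (simp add: act_def normal.inv_op_closed2)
next
  case (ops_one)
  then show ?case using normal_imp_subgroup subgroup.one_closed by blast
next
  case (ops_times f h)
  then show ?case using normal_imp_subgroup subgroup.m_closed by metis
next
  case (ops_inverse f)
  then show ?case using normal_imp_subgroup subgroup.m_inv_closed by metis
qed auto

lemma ops_closed [simp]: "f \<in> ops \<Longrightarrow> a \<in> A \<Longrightarrow> f a \<in> A"
  using ops_preserves_normal[OF _ A.normal_axioms] by blast

lemma ops_mult: "f \<in> ops \<Longrightarrow> a \<in> A \<Longrightarrow> b \<in> A \<Longrightarrow> f (a \<otimes> b) = f a \<otimes> f b"
  by (induction f arbitrary: a b rule: ops.induct) (simp_all add: act_mult A_ac)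

lemma ops_hom: "f \<in> ops \<Longrightarrow> group_hom (G\<lparr>carrier := A\<rparr>) (G\<lparr>carrier := A\<rparr>) f"
  using comm_group_A
  by (auto simp: group_hom_def group_hom_axioms_def comm_group_def ops_mult intro!: homI)

lemma ops_map_one [simp]: "f \<in> ops \<Longrightarrow> f \<one> = \<one>"
  using group_hom.hom_one[OF ops_hom] by fastforce

lemma ops_map_inv:
  assumes "f \<in> ops" "a \<in> A"
  shows "f (inv a) = inv (f a)"
  using group_hom.hom_inv[OF ops_hom[OF assms(1)], of a] assms
  by (simp add: m_inv_consistent[OF A.subgroup_axioms])

lemma ops_commute_act:
  "f \<in> ops \<Longrightarrow> g \<in> carrier G \<Longrightarrow> a \<in> A \<Longrightarrow> f (act g a) = act g (f a)"
proof (induction f arbitrary: a rule: ops.induct)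
  case (ops_one)
  then show ?case by (simp add: act_def)
qed (simp_all add: act_commute act_mult act_inv)

lemma ops_commute: "f \<in> ops \<Longrightarrow> h \<in> ops \<Longrightarrow> a \<in> A \<Longrightarrow> f (h a) = h (f a)"
  by (induction f arbitrary: a rule: ops.induct)
    (simp_all add: ops_commute_act ops_mult ops_map_inv)

section \<open>Monic polynomials in the action of one element\<close>

lemma ops_act_power: "z \<in> carrier G \<Longrightarrow> act z ^^ n \<in> ops"
proof (induction n)
  case 0
  then show ?case using ops_id by (simp add: id_def)
next
  case (Suc n)
  then show ?case using ops_comp[OF ops_act Suc.IH] by (simp add: comp_def)
qed

text \<open>Additively, these are the values at \<open>a\<close> of integer polynomials in
  \<open>z\<close> of degree below \<open>n\<close>; \<open>n = 0\<close> gives the trivial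
  group.\<close>

definition krylov :: "'a \<Rightarrow> nat \<Rightarrow> 'a \<Rightarrow> 'a set" where
  "krylov z n a = generate G ((\<lambda>i. (act z ^^ i) a) ` {..<n})"

lemma subgroup_krylov:
  assumes "z \<in> carrier G" "a \<in> A"
  shows "subgroup (krylov z n a) G"
  unfolding krylov_def using assms ops_act_power by (intro generate_is_subgroup) auto

lemma krylov_incl: "i < n \<Longrightarrow> (act z ^^ i) a \<in> krylov z n a"
  by (auto simp: krylov_def intro: generate.incl)

lemma krylov_minimal:
  assumes "subgroup H G" "\<And>i. i < n \<Longrightarrow> (act z ^^ i) a \<in> H"
  shows "krylov z n a \<subseteq> H"
  unfolding krylov_def using assms by (intro generate_subgroup_incl) auto

lemma krylov_subset:
  assumes "z \<in> carrier G" "a \<in> A"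
  shows "krylov z n a \<subseteq> A"
  using assms ops_act_power by (intro krylov_minimal A.subgroup_axioms) auto

lemma ops_image_generate:
  assumes f: "f \<in> ops" and S: "S \<subseteq> A" and H: "subgroup H G" "\<And>s. s \<in> S \<Longrightarrow> f s \<in> H"
    and x: "x \<in> generate G S"
  shows "f x \<in> H"
  using x
proof (induction x rule: generate.induct)
  case one
  then show ?case using f H by (simp add: subgroup.one_closed)
next
  case (incl s)
  then show ?case using H by simp
next
  case (inv s)
  then show ?case using ops_map_inv[OF f, of s] S H by (auto simp: subgroup.m_inv_closed)
next
  case (eng x y)
  have "x \<in> A" "y \<in> A"
    using eng(1,2) generate_subgroup_incl[OF S A.subgroup_axioms] by auto
  then show ?case using ops_mult[OF f, of x y] eng H by (simp add: subgroup.m_closed)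
qed

lemma krylov_shift:
  assumes z: "z \<in> carrier G" "a \<in> A" and x: "x \<in> krylov z m a" and le: "i + m \<le> n"
  shows "(act z ^^ i) x \<in> krylov z n a"
proof (rule ops_image_generate[OF ops_act_power[OF z(1)] _ subgroup_krylov[OF z]])
  show "(\<lambda>i. (act z ^^ i) a) ` {..<m} \<subseteq> A"
    using z ops_act_power by auto
  show "x \<in> generate G ((\<lambda>i. (act z ^^ i) a) ` {..<m})"
    using x by (simp add: krylov_def)
  fix s assume "s \<in> (\<lambda>i. (act z ^^ i) a) ` {..<m}"
  then obtain j where "j < m" "s = (act z ^^ j) a" by blast
  then show "(act z ^^ i) s \<in> krylov z n a"
    using krylov_incl[of "i + j" n z a] le by (simp add: funpow_add)
qed

text \<open>A pointwise form of being a monic polynomial of degree \<open>n\<close> in the operator \<open>act z\<close>.\<close>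

definition monic :: "'a \<Rightarrow> nat \<Rightarrow> ('a \<Rightarrow> 'a) \<Rightarrow> bool" where
  "monic z n f \<longleftrightarrow> f \<in> ops \<and> (\<forall>a\<in>A. \<exists>u \<in> krylov z n a. f a = (act z ^^ n) a \<otimes> u)"

lemma monic_ops: "monic z n f \<Longrightarrow> f \<in> ops"
  by (simp add: monic_def)

lemma monicI:
  assumes "z \<in> carrier G" "r \<in> ops" "\<And>a. a \<in> A \<Longrightarrow> r a \<in> krylov z n a"
  shows "monic z n (\<lambda>a. (act z ^^ n) a \<otimes> r a)"
  unfolding monic_def using assms ops_times[OF ops_act_power[OF assms(1)] assms(2)] by blast

text \<open>The leading terms compose to the power \<open>m + n\<close> of the action, and all other
  contributions have lower degree by \<open>krylov_shift\<close>.\<close>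

lemma monic_comp:
  assumes z: "z \<in> carrier G" and f: "monic z m f" and h: "monic z n h"
  shows "monic z (m + n) (\<lambda>a. f (h a))"
  unfolding monic_def
proof (intro conjI ballI)
  show "(\<lambda>a. f (h a)) \<in> ops" by (rule ops_comp[OF monic_ops[OF f] monic_ops[OF h]])
  fix a assume a: "a \<in> A"
  note sub = subgroup_krylov[OF z a, of "m + n"]
  obtain u where u: "u \<in> krylov z n a" "h a = (act z ^^ n) a \<otimes> u"
    using h a by (auto simp: monic_def)
  have uA: "u \<in> A" using u krylov_subset[OF z a] by blast
  have zA: "(act z ^^ i) x \<in> A" if "x \<in> A" for i x using ops_act_power[OF z] that by simp
  have pow: "(act z ^^ i) (h a) = (act z ^^ (i + n)) a \<otimes> (act z ^^ i) u" for i
    using u(2) ops_mult[OF ops_act_power[OF z] zA[OF a] uA] by (simp add: funpow_add)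
  have ha: "h a \<in> A" using monic_ops[OF h] a by simp
  then obtain v where v: "v \<in> krylov z m (h a)" "f (h a) = (act z ^^ m) (h a) \<otimes> v"
    using f by (auto simp: monic_def)
  have "krylov z m (h a) \<subseteq> krylov z (m + n) a"
  proof (rule krylov_minimal[OF sub])
    fix i assume "i < m"
    then show "(act z ^^ i) (h a) \<in> krylov z (m + n) a"
      unfolding pow
      by (intro subgroup.m_closed[OF sub] krylov_incl krylov_shift[OF z a u(1)]) auto
  qed
  then have v': "v \<in> krylov z (m + n) a" using v by blast
  have u': "(act z ^^ m) u \<in> krylov z (m + n) a"
    by (rule krylov_shift[OF z a u(1)]) simp
  have vA: "v \<in> A" using v' krylov_subset[OF z a] by blast
  have "f (h a) = (act z ^^ (m + n)) a \<otimes> ((act z ^^ m) u \<otimes> v)"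
    unfolding v(2) pow using vA zA[OF uA, of m] zA[OF a, of "m + n"] by (simp only: A_assoc)
  then show "\<exists>w \<in> krylov z (m + n) a. f (h a) = (act z ^^ (m + n)) a \<otimes> w"
    using subgroup.m_closed[OF sub u' v'] by blast
qed

lemma monic_id: "monic z 0 (\<lambda>a. a)"
  by (auto simp: monic_def ops_id krylov_def generate_empty)

lemma monic_power_minus_one:
  assumes "z \<in> carrier G" "0 < n"
  shows "monic z n (\<lambda>a. (act z ^^ n) a \<otimes> inv a)"
proof (rule monicI[OF assms(1) ops_inverse[OF ops_id]])
  fix a assume "a \<in> A"
  then show "inv a \<in> krylov z n a"
    using subgroup.m_inv_closed[OF subgroup_krylov[OF assms(1)] krylov_incl[of 0 n z a]] assms by simp
qed

text \<open>The polynomial producing \<open>u\<close> at the single point \<open>x\<close> is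
  rebuilt as an operator that obeys the degree bound at every point of \<open>A\<close>. This turns
  a linear dependence at one point into a monic operator.\<close>

lemma krylov_operator:
  assumes z: "z \<in> carrier G" and x: "x \<in> A" and u: "u \<in> krylov z n x"
  shows "\<exists>r \<in> ops. (\<forall>a\<in>A. r a \<in> krylov z n a) \<and> r x = u"
  using u unfolding krylov_def[of z n x]
proof (induction u rule: generate.induct)
  case one
  then show ?case
    using subgroup.one_closed[OF subgroup_krylov[OF z]] by (intro bexI[OF _ ops_one]) auto
next
  case (incl s)
  then obtain i where "i < n" "s = (act z ^^ i) x" by blast
  then show ?case
    using krylov_incl by (intro bexI[OF _ ops_act_power[OF z, of i]]) auto
next
  case (inv s)
  then obtain i where "i < n" "s = (act z ^^ i) x" by blast
  then show ?case
    using krylov_incl subgroup.m_inv_closed[OF subgroup_krylov[OF z]]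
    by (intro bexI[OF _ ops_inverse[OF ops_act_power[OF z, of i]]]) auto
next
  case (eng u v)
  then obtain r s where rs: "r \<in> ops" "\<forall>a\<in>A. r a \<in> krylov z n a" "r x = u"
    "s \<in> ops" "\<forall>a\<in>A. s a \<in> krylov z n a" "s x = v" by blast
  then show ?case
    using subgroup.m_closed[OF subgroup_krylov[OF z]]
    by (intro bexI[OF _ ops_times[OF rs(1,4)]]) auto
qed

section \<open>Submodules obtained by adjoining one element\<close>

definition ops_span :: "'a set \<Rightarrow> 'a \<Rightarrow> 'a set" where
  "ops_span K a = {k \<otimes> h a | k h. k \<in> K \<and> h \<in> ops}"

lemma ops_span_normal:
  assumes K: "K \<lhd> G" "K \<subseteq> A" and a: "a \<in> A"
  shows "ops_span K a \<lhd> G"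
proof -
  interpret K: normal K G by (rule K)
  have I: "k \<otimes> h a \<in> ops_span K a" if "k \<in> K" "h \<in> ops" for k h
    using that by (auto simp: ops_span_def)
  have KA: "k \<in> A" if "k \<in> K" for k using that K by blast
  show ?thesis
  proof (rule normal_invI)
    show "subgroup (ops_span K a) G"
    proof (rule subgroupI)
      show "ops_span K a \<subseteq> carrier G" using KA a by (auto simp: ops_span_def)
      show "ops_span K a \<noteq> {}" using I[OF K.one_closed ops_id] by blast
      fix x assume "x \<in> ops_span K a"
      then obtain k h where x: "k \<in> K" "h \<in> ops" "x = k \<otimes> h a" by (auto simp: ops_span_def)
      have "inv x = inv k \<otimes> inv (h a)" using x KA a by (simp add: A_inv_mult)
      then show "inv x \<in> ops_span K a" using I[OF K.m_inv_closed ops_inverse] x by metis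
      fix y assume "y \<in> ops_span K a"
      then obtain l f where y: "l \<in> K" "f \<in> ops" "y = l \<otimes> f a" by (auto simp: ops_span_def)
      have "x \<otimes> y = (k \<otimes> l) \<otimes> (h a \<otimes> f a)" using x y KA a by (simp add: A_ac)
      then show "x \<otimes> y \<in> ops_span K a" using I[OF K.m_closed ops_times] x y by metis
    qed
    fix g x assume g: "g \<in> carrier G" and "x \<in> ops_span K a"
    then obtain k h where x: "k \<in> K" "h \<in> ops" "x = k \<otimes> h a" by (auto simp: ops_span_def)
    have "act g x = act g k \<otimes> act g (h a)" using x g KA a by (simp add: act_mult)
    moreover have "act g k \<in> K" using x g by (simp add: act_def K.inv_op_closed2)
    ultimately have "act g x \<in> ops_span K a" using I[OF _ ops_comp[OF ops_act[OF g] x(2)]] by simp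
    then show "g \<otimes> x \<otimes> inv g \<in> ops_span K a" by (simp add: act_def)
  qed
qed

lemma ops_span_subset: "K \<subseteq> A \<Longrightarrow> a \<in> A \<Longrightarrow> ops_span K a \<subseteq> A"
  by (auto simp: ops_span_def)

lemma ops_span_incl:
  assumes "K \<lhd> G" "K \<subseteq> A" "a \<in> A"
  shows "K \<subseteq> ops_span K a" "a \<in> ops_span K a"
proof -
  interpret K: normal K G by (rule assms)
  have "k \<otimes> (\<lambda>a. \<one>) a \<in> ops_span K a" if "k \<in> K" for k
    unfolding ops_span_def using that ops_one
    by (intro CollectI exI[of _ k] exI[of _ "\<lambda>a. \<one>"]) simp
  then show "K \<subseteq> ops_span K a" by auto
  have "\<one> \<otimes> (\<lambda>a. a) a \<in> ops_span K a"
    unfolding ops_span_def using ops_id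
    by (intro CollectI exI[of _ \<one>] exI[of _ "\<lambda>a. a"]) simp
  then show "a \<in> ops_span K a" using assms by simp
qed

end

section \<open>Descent along a finitely presented group\<close>

text \<open>Modulo \<open>K\<close> the module \<open>ops_span K a\<^sub>0\<close> is cyclic, hence a quotient ring of the group ring.
  The form \<open>\<mu>\<close> pulls its multiplication back along \<open>\<phi>\<close>.\<close>

locale module_to_cyclic = abelian_by_abelian +
  fixes K a\<^sub>0 \<phi>
  assumes K_normal: "K \<lhd> G" and K_subset: "K \<subseteq> A" and a\<^sub>0: "a\<^sub>0 \<in> A"
    and \<phi>_ops: "\<phi> \<in> ops" and \<phi>_span: "a \<in> A \<Longrightarrow> \<phi> a \<in> ops_span K a\<^sub>0"
begin

abbreviation "V \<equiv> G\<lparr>carrier := A\<rparr> Mod K"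

definition proj :: "'a \<Rightarrow> 'a set" where
  "proj x = K #> x"

text \<open>A representative of \<open>\<phi> a\<close> in the quotient ring. It is determined only
  up to operators that send \<open>a\<^sub>0\<close> into \<open>K\<close>, so \<open>coord\<close>
  itself need not be additive, whereas \<open>\<mu>\<close> is.\<close>

definition coord :: "'a \<Rightarrow> 'a \<Rightarrow> 'a" where
  "coord a = (SOME h. h \<in> ops \<and> (\<exists>k \<in> K. \<phi> a = k \<otimes> h a\<^sub>0))"

definition \<mu> :: "'a \<Rightarrow> 'a \<Rightarrow> 'a set" where
  "\<mu> a b = proj (coord a (\<phi> b))"

sublocale K: normal K G by (rule K_normal)

sublocale GA: comm_group "G\<lparr>carrier := A\<rparr>" by (rule comm_group_A)

lemma K_subgroup_A: "subgroup K (G\<lparr>carrier := A\<rparr>)"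
  by (rule GA.group_incl_imp_subgroup)
    (use K_subset subgroup_imp_group[OF K.subgroup_axioms] in auto)

sublocale V: comm_group V
  by (rule GA.abelian_FactGroup[OF K_subgroup_A])

lemma proj_hom: "proj \<in> hom (G\<lparr>carrier := A\<rparr>) V"
proof -
  have "normal K (G\<lparr>carrier := A\<rparr>)"
    using K_subgroup_A by (simp add: GA.normal_iff_subgroup)
  from normal.r_coset_hom_Mod[OF this] show ?thesis by (simp add: proj_def[abs_def])
qed

sublocale proj: group_hom "G\<lparr>carrier := A\<rparr>" V proj
  by unfold_locales (rule proj_hom)

lemma proj_closed [simp]: "x \<in> A \<Longrightarrow> proj x \<in> carrier V"
  using proj.hom_closed by simp

lemma proj_mult: "x \<in> A \<Longrightarrow> y \<in> A \<Longrightarrow> proj (x \<otimes> y) = proj x \<otimes>\<^bsub>V\<^esub> proj y"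
  using proj.hom_mult[of x y] by simp

lemma proj_inv: "x \<in> A \<Longrightarrow> proj (inv x) = inv\<^bsub>V\<^esub> (proj x)"
  using proj.hom_inv[of x] m_inv_consistent[OF A.subgroup_axioms, of x] by simp

lemma proj_eq_iff:
  assumes "x \<in> A" "y \<in> A"
  shows "proj x = proj y \<longleftrightarrow> x \<otimes> inv y \<in> K"
proof -
  have c: "x \<in> carrier G" "y \<in> carrier G" using assms by auto
  have "proj x = proj y \<longleftrightarrow> x \<in> K #> y"
    using rcos_self[OF c(1) K.subgroup_axioms] repr_independence[OF _ c(2) K.subgroup_axioms]
    by (auto simp: proj_def)
  then show ?thesis using K.rcos_module[OF is_group c(2,1)] by simp
qed

lemma proj_one: "proj \<one> = \<one>\<^bsub>V\<^esub>"
  using proj.hom_one by simp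

lemma proj_K_mult: "k \<in> K \<Longrightarrow> x \<in> A \<Longrightarrow> proj (k \<otimes> x) = proj x"
  using K_subset by (simp add: proj_eq_iff subset_iff m_assoc)

lemma proj_ops:
  assumes "h \<in> ops" "x \<in> A" "y \<in> A" "proj x = proj y"
  shows "proj (h x) = proj (h y)"
proof -
  have "x \<otimes> inv y \<in> K" using assms(2-4) by (simp only: proj_eq_iff)
  then have "h (x \<otimes> inv y) \<in> K" by (rule ops_preserves_normal[OF assms(1) K_normal K_subset])
  moreover have "h (x \<otimes> inv y) = h x \<otimes> inv (h y)"
    using assms(1-3) by (simp add: ops_mult ops_map_inv)
  ultimately show ?thesis
    using proj_eq_iff[OF ops_closed[OF assms(1,2)] ops_closed[OF assms(1,3)]] by simp
qed

lemma coord: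
  assumes "a \<in> A"
  shows "coord a \<in> ops" "proj (\<phi> a) = proj (coord a a\<^sub>0)"
proof -
  have "\<exists>h. h \<in> ops \<and> (\<exists>k \<in> K. \<phi> a = k \<otimes> h a\<^sub>0)"
    using \<phi>_span[OF assms] by (auto simp: ops_span_def)
  from someI_ex[OF this] have c: "coord a \<in> ops \<and> (\<exists>k \<in> K. \<phi> a = k \<otimes> coord a a\<^sub>0)"
    unfolding coord_def .
  then show "coord a \<in> ops" ..
  from c obtain k where k: "k \<in> K" "\<phi> a = k \<otimes> coord a a\<^sub>0" by blast
  show "proj (\<phi> a) = proj (coord a a\<^sub>0)"
    unfolding k(2) using c a\<^sub>0 k(1) by (intro proj_K_mult) auto
qed

lemma \<phi>_closed [simp]: "a \<in> A \<Longrightarrow> \<phi> a \<in> A"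
  using \<phi>_ops by simp

lemma \<mu>_closed [simp]: "a \<in> A \<Longrightarrow> b \<in> A \<Longrightarrow> \<mu> a b \<in> carrier V"
  unfolding \<mu>_def by (rule proj_closed[OF ops_closed[OF coord(1) \<phi>_closed]])

text \<open>Both sides are the class of \<open>coord a (coord b a\<^sub>0)\<close>, because
  operators commute. Additivity on the right is immediate, and symmetry carries it to the
  left.\<close>

lemma \<mu>_sym:
  assumes "a \<in> A" "b \<in> A"
  shows "\<mu> a b = \<mu> b a"
proof -
  note c = coord[OF assms(1)] coord[OF assms(2)]
  have "\<mu> a b = proj (coord a (coord b a\<^sub>0))"
    unfolding \<mu>_def by (rule proj_ops[OF c(1) \<phi>_closed[OF assms(2)] ops_closed[OF c(3) a\<^sub>0] c(4)])
  also have "\<dots> = proj (coord b (coord a a\<^sub>0))"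
    by (simp only: ops_commute[OF c(1,3) a\<^sub>0])
  also have "\<dots> = \<mu> b a"
    unfolding \<mu>_def
    by (rule proj_ops[OF c(3) \<phi>_closed[OF assms(1)] ops_closed[OF c(1) a\<^sub>0] c(2), symmetric])
  finally show ?thesis .
qed

lemma \<mu>_mult_right:
  assumes "a \<in> A" "b \<in> A" "c \<in> A"
  shows "\<mu> a (b \<otimes> c) = \<mu> a b \<otimes>\<^bsub>V\<^esub> \<mu> a c"
  unfolding \<mu>_def using assms coord[OF assms(1)]
  by (simp only: ops_mult[OF \<phi>_ops] ops_mult \<phi>_closed proj_mult ops_closed)

lemma \<mu>_mult_left:
  assumes "a \<in> A" "b \<in> A" "c \<in> A"
  shows "\<mu> (a \<otimes> b) c = \<mu> a c \<otimes>\<^bsub>V\<^esub> \<mu> b c"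
  using assms by (simp only: \<mu>_sym[of _ c] \<mu>_mult_right A.m_closed)

lemma \<mu>_one_right: "a \<in> A \<Longrightarrow> \<mu> a \<one> = \<one>\<^bsub>V\<^esub>"
  unfolding \<mu>_def using coord[of a] \<phi>_ops by (simp only: ops_map_one proj_one)

lemma \<mu>_one_left: "a \<in> A \<Longrightarrow> \<mu> \<one> a = \<one>\<^bsub>V\<^esub>"
  using \<mu>_sym[of "\<one>" a] \<mu>_one_right by simp

text \<open>Operators are defined on \<open>A\<close> and not on \<open>V\<close>, so the module
  action on a value of \<open>\<mu>\<close> is expressed by applying \<open>h\<close> to a
  representative. The lemma for the left argument has the same right-hand side, which makes the two
  comparable.\<close>

lemma \<mu>_ops_right:
  assumes "h \<in> ops" "a \<in> A" "b \<in> A"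
  shows "\<mu> a (h b) = proj (h (coord a (\<phi> b)))"
  unfolding \<mu>_def
  by (simp only: ops_commute[OF \<phi>_ops assms(1,3)]
      ops_commute[OF coord(1)[OF assms(2)] assms(1) \<phi>_closed[OF assms(3)]])

lemma \<mu>_ops_left:
  assumes "h \<in> ops" "a \<in> A" "b \<in> A"
  shows "\<mu> (h a) b = proj (h (coord a (\<phi> b)))"
proof -
  have "\<mu> (h a) b = proj (h (coord b (\<phi> a)))"
    by (simp only: \<mu>_sym[OF ops_closed[OF assms(1,2)] assms(3)] \<mu>_ops_right[OF assms(1,3,2)])
  also have "\<dots> = proj (h (coord a (\<phi> b)))"
    using \<mu>_sym[OF assms(3,2)] unfolding \<mu>_def
    by (rule proj_ops[OF assms(1) ops_closed[OF coord(1)] ops_closed[OF coord(1)],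
          OF assms(3) \<phi>_closed[OF assms(2)] assms(2) \<phi>_closed[OF assms(3)]])
  finally show ?thesis .
qed

text \<open>By bilinearity over the operators the two actions combine and cancel. Together with an
  automorphism that inverts the action this gives a \<open>G\<close>-invariant form.\<close>

lemma \<mu>_act_act_inv:
  assumes "g \<in> carrier G" "a \<in> A" "b \<in> A"
  shows "\<mu> (act g a) (act (inv g) b) = \<mu> a b"
proof -
  have ag: "act (inv g) \<in> ops" "act g \<in> ops" using assms by (simp_all add: ops_act)
  have "\<mu> (act g a) (act (inv g) b) = proj (act (inv g) (coord (act g a) (\<phi> b)))"
    using \<mu>_ops_right[OF ag(1)] assms by simp
  also have "\<dots> = proj (act (inv g) (act g (coord a (\<phi> b))))"
    using \<mu>_ops_left[OF ag(2) assms(2,3)] unfolding \<mu>_def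
    by (rule proj_ops[OF ag(1) ops_closed[OF coord(1)] ops_closed[OF ag(2) ops_closed[OF coord(1)]],
          OF ops_closed[OF ag(2) assms(2)] \<phi>_closed[OF assms(3)] assms(2) \<phi>_closed[OF assms(3)]])
  also have "\<dots> = \<mu> a b"
    using assms coord unfolding \<mu>_def by simp
  finally show ?thesis .
qed

end

section \<open>The inverting automorphism and the cup product cocycle\<close>

locale inverting_automorphism = abelian_by_abelian +
  fixes \<iota>
  assumes \<iota>_iso: "\<iota> \<in> iso G G" and \<iota>_image: "\<iota> ` A = A"
    and \<iota>_inverts: "g \<in> carrier G \<Longrightarrow> \<iota> g \<otimes> g \<in> A"
begin

sublocale \<iota>: group_hom G G \<iota>
  using \<iota>_iso by unfold_locales (simp add: iso_def)

lemma \<iota>_closed [simp]: "a \<in> A \<Longrightarrow> \<iota> a \<in> A"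
  using \<iota>_image by blast

text \<open>Modulo \<open>A\<close> the element \<open>\<iota> g\<close> is the inverse of
  \<open>g\<close>, and \<open>A\<close> acts trivially on itself.\<close>

lemma \<iota>_act:
  assumes g: "g \<in> carrier G" and a: "a \<in> A"
  shows "\<iota> (act g a) = act (inv g) (\<iota> a)"
proof -
  have "\<iota> (act g a) = act (\<iota> g) (\<iota> a)"
    using g a by (simp add: act_def)
  also have "\<dots> = act ((\<iota> g \<otimes> g) \<otimes> inv g) (\<iota> a)"
    using g by (simp add: m_assoc)
  also have "\<dots> = act (\<iota> g \<otimes> g) (act (inv g) (\<iota> a))"
    using g a by (simp only: act_act inv_closed \<iota>.hom_closed m_closed \<iota>_closed)
  also have "\<dots> = act (inv g) (\<iota> a)"
    using g a \<iota>_inverts by simp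
  finally show ?thesis .
qed

end

locale inverting_module_to_cyclic = inverting_automorphism + module_to_cyclic +
  fixes z
  assumes z: "z \<in> carrier G"
begin

definition deriv :: "'a \<Rightarrow> 'a" where
  "deriv g = z \<otimes> g \<otimes> inv z \<otimes> inv g"

definition cup :: "'a \<Rightarrow> 'a \<Rightarrow> 'a set" where
  "cup g h = \<mu> (deriv g) (\<iota> (act g (deriv h)))"

lemma deriv_closed [simp]: "g \<in> carrier G \<Longrightarrow> deriv g \<in> A"
  using commutator_in_A[OF z] by (simp add: deriv_def)

lemma deriv_one: "deriv \<one> = \<one>"
  using z by (simp add: deriv_def)

lemma deriv_mult:
  assumes "g \<in> carrier G" "h \<in> carrier G"
  shows "deriv (g \<otimes> h) = deriv g \<otimes> act g (deriv h)"
  using assms z by (simp add: deriv_def act_def m_assoc inv_mult_group mult_inv_mult_cancel)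

lemma deriv_A: "a \<in> A \<Longrightarrow> deriv a = act z a \<otimes> inv a"
  by (simp add: deriv_def act_def)

text \<open>With \<open>?x\<close>, \<open>?y\<close>, \<open>?w\<close> as in the proof, both sides
  of the cocycle identity expand to the terms \<open>\<mu> ?x (\<iota> ?y)\<close>,
  \<open>\<mu> ?x (\<iota> ?w)\<close> and \<open>\<mu> ?y (\<iota> ?w)\<close>. The last one equals
  \<open>cup h k\<close>, as \<open>\<iota>\<close> turns the action of \<open>g\<close> into that
  of \<open>inv g\<close> and the two cancel.\<close>

lemma cup_normalized_cocycle: "normalized_cocycle G V cup"
proof (unfold_locales)
  fix g assume g: "g \<in> carrier G"
  show "cup \<one> g = \<one>\<^bsub>V\<^esub>"
    using g by (simp add: cup_def deriv_one \<mu>_one_left)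
  show "cup g \<one> = \<one>\<^bsub>V\<^esub>"
    using g by (simp add: cup_def deriv_one \<mu>_one_right ops_map_one[OF ops_act[OF g]])
  fix h assume h: "h \<in> carrier G"
  show "cup g h \<in> carrier V"
    using g h unfolding cup_def by (intro \<mu>_closed \<iota>_closed act_closed deriv_closed)
  fix k assume k: "k \<in> carrier G"
  let ?x = "deriv g" and ?y = "act g (deriv h)" and ?w = "act g (act h (deriv k))"
  have A: "?x \<in> A" "?y \<in> A" "?w \<in> A" using g h k by auto
  have "cup (g \<otimes> h) k = \<mu> ?x (\<iota> ?w) \<otimes>\<^bsub>V\<^esub> \<mu> ?y (\<iota> ?w)"
    using A g h k unfolding cup_def
    by (simp only: deriv_mult act_act[symmetric] deriv_closed \<mu>_mult_left \<iota>_closed)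
  moreover have "cup g (h \<otimes> k) = cup g h \<otimes>\<^bsub>V\<^esub> \<mu> ?x (\<iota> ?w)"
  proof -
    have "\<iota> (act g (deriv (h \<otimes> k))) = \<iota> ?y \<otimes> \<iota> ?w"
      using g h k A by (simp add: deriv_mult act_mult)
    then show ?thesis using A unfolding cup_def by (simp only: \<mu>_mult_right \<iota>_closed)
  qed
  moreover have "cup h k = \<mu> ?y (\<iota> ?w)"
    using g h k unfolding cup_def by (simp add: \<iota>_act[of g] \<mu>_act_act_inv)
  moreover have "cup g h \<in> carrier V"
    using g h unfolding cup_def by (intro \<mu>_closed \<iota>_closed act_closed deriv_closed)
  moreover have "\<mu> ?x (\<iota> ?w) \<in> carrier V" "\<mu> ?y (\<iota> ?w) \<in> carrier V"
    using A by (simp_all only: \<mu>_closed \<iota>_closed)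
  ultimately show "cup g h \<otimes>\<^bsub>V\<^esub> cup (g \<otimes> h) k = cup h k \<otimes>\<^bsub>V\<^esub> cup g (h \<otimes> k)"
    by (simp only: V.m_ac V.m_closed)
qed

end


section \<open>Finite generation from the commutator defect\<close>

context inverting_module_to_cyclic
begin

definition \<delta> :: "'a \<Rightarrow> 'a" where
  "\<delta> a = act z a \<otimes> inv a"

text \<open>Multiplication by \<open>z^2 - 1\<close>, the factor left over when one of the two terms
  of the skew form is eliminated.\<close>

definition \<theta> :: "'a \<Rightarrow> 'a" where
  "\<theta> a = act z (act z a) \<otimes> inv a"

lemma \<delta>_monic: "monic z 1 \<delta>"
  using monic_power_minus_one[OF z, of 1] by (simp add: \<delta>_def[abs_def])

lemma \<theta>_monic: "monic z 2 \<theta>"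
  using monic_power_minus_one[OF z, of 2] by (simp add: \<theta>_def[abs_def] numeral_2_eq_2)

lemmas \<delta>_ops = monic_ops[OF \<delta>_monic] and \<theta>_ops = monic_ops[OF \<theta>_monic]

lemma \<delta>_closed [simp]: "a \<in> A \<Longrightarrow> \<delta> a \<in> A"
  by (rule ops_closed[OF \<delta>_ops])

lemma proj_generate:
  assumes "S \<subseteq> A"
  shows "generate V (proj ` S) = proj ` generate G S"
  using proj.generate_img[of S] assms generate_consistent[OF assms A.subgroup_axioms] by simp

lemma cup_A: "a \<in> A \<Longrightarrow> b \<in> A \<Longrightarrow> cup a b = \<mu> (\<delta> a) (\<iota> (\<delta> b))"
  by (simp add: cup_def deriv_A[folded \<delta>_def])

text \<open>Elements of \<open>A\<close> commute, so the defect of \<open>cup\<close> is controlled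
  at all pairs in \<open>A\<close>. The generators found in \<open>V\<close> are replaced by
  representatives in \<open>A\<close>.\<close>

lemma skew_form_finitely_generated:
  assumes "finitely_presented G"
  obtains S where "finite S" "S \<subseteq> A"
    "\<And>a b. a \<in> A \<Longrightarrow> b \<in> A \<Longrightarrow> \<exists>s \<in> generate G S.
      proj (coord (\<delta> a) (\<phi> (\<iota> (\<delta> b))) \<otimes> inv (coord (\<delta> b) (\<phi> (\<iota> (\<delta> a))))) = proj s"
proof -
  interpret cup: normalized_cocycle G V cup by (rule cup_normalized_cocycle)
  obtain T where T: "finite T" "T \<subseteq> carrier V"
    and comm: "\<And>a b. \<lbrakk> a \<in> carrier G; b \<in> carrier G; a \<otimes> b = b \<otimes> a \<rbrakk> \<Longrightarrow>
      cup a b \<otimes>\<^bsub>V\<^esub> inv\<^bsub>V\<^esub> (cup b a) \<in> generate V T"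
    by (rule cup.finite_presentation_commutator_defect[OF assms]) (rule that)
  have "carrier V = proj ` A"
    unfolding carrier_FactGroup proj_def[abs_def] by simp
  then obtain S where S: "finite S" "S \<subseteq> A" "T = proj ` S"
    using T finite_subset_image by metis
  show thesis
  proof (rule that[OF S(1,2)])
    fix a b assume ab: "a \<in> A" "b \<in> A"
    let ?x = "coord (\<delta> a) (\<phi> (\<iota> (\<delta> b)))" and ?y = "coord (\<delta> b) (\<phi> (\<iota> (\<delta> a)))"
    have xy: "?x \<in> A" "?y \<in> A"
      by (intro ops_closed[OF coord(1)] \<phi>_closed \<iota>_closed \<delta>_closed ab)+
    have "cup a b \<otimes>\<^bsub>V\<^esub> inv\<^bsub>V\<^esub> (cup b a) \<in> generate V T"
      using ab A_commute by (intro comm) auto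
    also have "cup a b \<otimes>\<^bsub>V\<^esub> inv\<^bsub>V\<^esub> (cup b a) = proj (?x \<otimes> inv ?y)"
      using proj_mult[OF xy(1) A.m_inv_closed[OF xy(2)]] proj_inv[OF xy(2)]
      by (simp only: cup_A[OF ab] cup_A[OF ab(2,1)] \<mu>_def)
    finally show "\<exists>s \<in> generate G S. proj (?x \<otimes> inv ?y) = proj s"
      unfolding S(3) proj_generate[OF S(2)] by blast
  qed
qed

text \<open>Substituting \<open>act z a\<close> for \<open>a\<close> multiplies the two terms of the skew form by \<open>z\<close> and by
  \<open>z\<^sup>-\<^sup>1\<close>, so the second term can be isolated.\<close>

lemma form_finitely_generated:
  assumes "finitely_presented G"
  obtains S where "finite S" "S \<subseteq> A"
    "\<And>a b. a \<in> A \<Longrightarrow> b \<in> A \<Longrightarrow> \<exists>s \<in> generate G S. proj (\<theta> (coord (\<delta> b) (\<phi> (\<iota> (\<delta> a))))) = proj s"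
proof -
  obtain T where T: "finite T" "T \<subseteq> A"
    and skew: "\<And>a b. a \<in> A \<Longrightarrow> b \<in> A \<Longrightarrow> \<exists>s \<in> generate G T.
      proj (coord (\<delta> a) (\<phi> (\<iota> (\<delta> b))) \<otimes> inv (coord (\<delta> b) (\<phi> (\<iota> (\<delta> a))))) = proj s"
    by (rule skew_form_finitely_generated[OF assms]) (rule that)
  note z_ops = ops_act[OF z]
  have zz_ops: "(\<lambda>a. act z (act z a)) \<in> ops" by (rule ops_comp[OF z_ops z_ops])
  \<comment> \<open>The relation for \<open>act z a\<close> will be multiplied by \<open>z\<close>
    and the original one by \<open>z^2\<close>, which moves their right-hand sides into these
    translates of \<open>T\<close>.\<close>
  define S where "S = act z ` T \<union> (\<lambda>a. act z (act z a)) ` T"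
  have S: "finite S" "S \<subseteq> A" using T z by (auto simp: S_def)
  have TA: "generate G T \<subseteq> A" by (rule generate_subgroup_incl[OF T(2) A.subgroup_axioms])
  interpret S: subgroup "generate G S" G
    by (rule generate_is_subgroup) (use S A.subset in blast)
  show thesis
  proof (rule that[OF S])
    fix a b assume ab: "a \<in> A" "b \<in> A"
    define x where "x = coord (\<delta> a) (\<phi> (\<iota> (\<delta> b)))"
    define y where "y = coord (\<delta> b) (\<phi> (\<iota> (\<delta> a)))"
    have xy: "x \<in> A" "y \<in> A"
      unfolding x_def y_def by (intro ops_closed[OF coord(1)] \<phi>_closed \<iota>_closed \<delta>_closed ab)+
    obtain s where s: "s \<in> generate G T" "proj (x \<otimes> inv y) = proj s"
      using skew[OF ab] unfolding x_def y_def by blast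
    have za: "act z a \<in> A" using z ab by simp
    obtain t where t: "t \<in> generate G T"
      "proj (coord (\<delta> (act z a)) (\<phi> (\<iota> (\<delta> b))) \<otimes> inv (coord (\<delta> b) (\<phi> (\<iota> (\<delta> (act z a)))))) = proj t"
      using skew[OF za ab(2)] by blast
    have st: "s \<in> A" "t \<in> A" using s t TA by auto
    have \<delta>z: "\<delta> (act z a) = act z (\<delta> a)" by (rule ops_commute[OF \<delta>_ops z_ops ab(1)])
    have in_A: "\<delta> a \<in> A" "\<delta> b \<in> A" "\<iota> (\<delta> a) \<in> A" "\<iota> (\<delta> b) \<in> A" using ab by auto
    have zx: "proj (coord (\<delta> (act z a)) (\<phi> (\<iota> (\<delta> b)))) = proj (act z x)"
      using \<mu>_ops_left[OF z_ops in_A(1,4)] unfolding \<mu>_def \<delta>z x_def .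
    have zy: "proj (coord (\<delta> b) (\<phi> (\<iota> (\<delta> (act z a))))) = proj (act (inv z) y)"
      using \<mu>_ops_right[OF ops_act[OF inv_closed[OF z]] in_A(2,3)]
      unfolding \<mu>_def \<delta>z y_def \<iota>_act[OF z in_A(1)] .
    have zxy: "act z x \<in> A" "act (inv z) y \<in> A" using xy z by auto
    have "proj (act z x \<otimes> inv (act (inv z) y)) = proj t"
    proof -
      have c: "coord (\<delta> (act z a)) (\<phi> (\<iota> (\<delta> b))) \<in> A" "coord (\<delta> b) (\<phi> (\<iota> (\<delta> (act z a)))) \<in> A"
        by (intro ops_closed[OF coord(1)] \<phi>_closed \<iota>_closed \<delta>_closed za ab)+
      show ?thesis
        unfolding t(2)[symmetric]
        by (simp only: proj_mult[OF zxy(1) A.m_inv_closed[OF zxy(2)]] proj_inv[OF zxy(2)]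
            proj_mult[OF c(1) A.m_inv_closed[OF c(2)]] proj_inv[OF c(2)] zx zy)
    qed
    \<comment> \<open>Additively and modulo \<open>K\<close>, the relation
      \<open>z x - z^(-1) y = t\<close> becomes \<open>z^2 x - y = z t\<close>.\<close>
    then have "proj (act z (act z x \<otimes> inv (act (inv z) y))) = proj (act z t)"
      using st zxy by (intro proj_ops[OF z_ops]) auto
    then have 1: "proj (act z (act z x) \<otimes> inv y) = proj (act z t)"
      using xy z by (simp add: act_mult act_inv)
    \<comment> \<open>Likewise \<open>x - y = s\<close> becomes
      \<open>z^2 x - z^2 y = z^2 s\<close>; the difference of the two relations is
      \<open>(z^2 - 1) y = z t - z^2 s\<close>, free of \<open>x\<close>.\<close>
    have "proj (act z (act z (x \<otimes> inv y))) = proj (act z (act z s))"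
      using s(2) st xy by (intro proj_ops[OF zz_ops]) auto
    then have 2: "proj (act z (act z x) \<otimes> inv (act z (act z y))) = proj (act z (act z s))"
      using xy z by (simp add: act_mult act_inv)
    let ?u = "act z (act z x)" and ?v = "act z (act z y)" and ?s = "act z (act z s)"
    have A: "?u \<in> A" "?v \<in> A" "?s \<in> A" "act z t \<in> A" using xy st z by auto
    have "\<theta> y = (?u \<otimes> inv y) \<otimes> inv (?u \<otimes> inv ?v)"
      using A xy by (simp add: \<theta>_def A_ac mult_inv_mult_cancel)
    then have "proj (\<theta> y) = proj (?u \<otimes> inv y) \<otimes>\<^bsub>V\<^esub> inv\<^bsub>V\<^esub> (proj (?u \<otimes> inv ?v))"
      using A xy by (simp only: proj_mult proj_inv A.m_closed A.m_inv_closed)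
    also have "\<dots> = proj (act z t \<otimes> inv ?s)"
      using A unfolding 1 2 by (simp only: proj_mult proj_inv A.m_closed A.m_inv_closed)
    finally have "proj (\<theta> y) = proj (act z t \<otimes> inv ?s)" .
    moreover have "act z t \<in> generate G S"
      by (rule ops_image_generate[OF z_ops T(2) S.subgroup_axioms _ t(1)])
        (auto simp: S_def intro: generate.incl)
    moreover have "?s \<in> generate G S"
      by (rule ops_image_generate[OF zz_ops T(2) S.subgroup_axioms _ s(1)])
        (auto simp: S_def intro: generate.incl)
    ultimately show "\<exists>s \<in> generate G S. proj (\<theta> (coord (\<delta> b) (\<phi> (\<iota> (\<delta> a))))) = proj s"
      unfolding y_def by blast
  qed
qed

text \<open>Additively, choose \<open>a\<close> with \<open>\<iota> a = - z w\<close>. As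
  \<open>\<iota>\<close> turns \<open>z\<close> into its inverse, the identity
  \<open>(z^(-1) - 1) (- z w) = (z - 1) w\<close> gives the claim.\<close>

lemma \<iota>_\<delta>_surj:
  assumes "w \<in> A"
  obtains a where "a \<in> A" "\<iota> (\<delta> a) = \<delta> w"
proof -
  have "inv (act z w) \<in> \<iota> ` A" unfolding \<iota>_image using z assms by simp
  then obtain a where a: "a \<in> A" "\<iota> a = inv (act z w)" by force
  have "\<iota> (\<delta> a) = act (inv z) (\<iota> a) \<otimes> inv (\<iota> a)"
    using a(1) z by (simp add: \<delta>_def \<iota>_act)
  also have "\<dots> = inv w \<otimes> act z w"
    using a(2) assms z by (simp add: act_inv)
  also have "\<dots> = \<delta> w"
    using assms z by (simp add: \<delta>_def A_commute)
  finally show thesis using that a(1) by blast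
qed

text \<open>One \<open>\<delta>\<close> and one \<open>\<phi>\<close> stem from each argument of
  \<open>cup\<close>, and \<open>\<theta>\<close> from isolating a term of the skew form.\<close>

definition \<epsilon> :: "'a \<Rightarrow> 'a" where
  "\<epsilon> a = \<theta> (\<phi> (\<delta> (\<phi> (\<delta> a))))"

lemma \<epsilon>_monic:
  assumes "monic z d \<phi>"
  shows "\<exists>n. monic z n \<epsilon>"
  using monic_comp[OF z \<theta>_monic monic_comp[OF z assms monic_comp[OF z \<delta>_monic
        monic_comp[OF z assms \<delta>_monic]]]]
  unfolding \<epsilon>_def[abs_def] by blast

text \<open>In the form take \<open>b = a\<^sub>0\<close>, and choose \<open>a\<close> with
  \<open>\<iota> (\<delta> a) = \<delta> (h a\<^sub>0)\<close>; commuting the operators produces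
  \<open>h (\<epsilon> a\<^sub>0)\<close> modulo \<open>K\<close>. Thus the submodule generated by
  \<open>\<epsilon> a\<^sub>0\<close> lies, modulo \<open>K\<close>, in a finitely generated abelian
  group.\<close>

lemma cyclic_module_finitely_generated:
  assumes "finitely_presented G"
  obtains S where "finite S" "S \<subseteq> A"
    "\<And>h. h \<in> ops \<Longrightarrow> \<exists>s \<in> generate G S. proj (h (\<epsilon> a\<^sub>0)) = proj s"
proof -
  obtain S where S: "finite S" "S \<subseteq> A"
    and form: "\<And>a b. a \<in> A \<Longrightarrow> b \<in> A \<Longrightarrow>
      \<exists>s \<in> generate G S. proj (\<theta> (coord (\<delta> b) (\<phi> (\<iota> (\<delta> a))))) = proj s"
    by (rule form_finitely_generated[OF assms]) (rule that)
  show thesis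
  proof (rule that[OF S])
    fix h assume h: "h \<in> ops"
    have \<delta>a: "\<delta> a\<^sub>0 \<in> A" using a\<^sub>0 by simp
    have ha: "h a\<^sub>0 \<in> A" using h a\<^sub>0 by simp
    obtain a where a: "a \<in> A" "\<iota> (\<delta> a) = \<delta> (h a\<^sub>0)" using \<iota>_\<delta>_surj[OF ha] .
    let ?F = "coord (\<delta> a\<^sub>0)"
    note F = coord[OF \<delta>a]
    \<comment> \<open>Gathering these operators in \<open>g\<close> allows \<open>?F\<close> to be
      moved next to \<open>a\<^sub>0\<close>, where it represents
      \<open>\<phi> (\<delta> a\<^sub>0)\<close>.\<close>
    define g where "g x = h (\<phi> (\<delta> x))" for x
    have g: "g \<in> ops"
      unfolding g_def[abs_def] by (intro ops_comp[OF h] ops_comp[OF \<phi>_ops] \<delta>_ops)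
    have "\<phi> (\<delta> (h a\<^sub>0)) = g a\<^sub>0"
      unfolding g_def using ops_commute[OF \<delta>_ops h a\<^sub>0] ops_commute[OF \<phi>_ops h \<delta>a] by simp
    then have "?F (\<phi> (\<iota> (\<delta> a))) = g (?F a\<^sub>0)"
      using ops_commute[OF F(1) g a\<^sub>0] a(2) by simp
    moreover have "proj (\<theta> (g (?F a\<^sub>0))) = proj (\<theta> (g (\<phi> (\<delta> a\<^sub>0))))"
      using F(2) by (intro proj_ops[OF ops_comp[OF \<theta>_ops g]] ops_closed[OF F(1) a\<^sub>0] \<phi>_closed \<delta>a) simp
    moreover have "\<theta> (g (\<phi> (\<delta> a\<^sub>0))) = h (\<epsilon> a\<^sub>0)"
      unfolding g_def \<epsilon>_def by (rule ops_commute[OF \<theta>_ops h]) (simp add: \<delta>a)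
    ultimately show "\<exists>s \<in> generate G S. proj (h (\<epsilon> a\<^sub>0)) = proj s"
      using form[OF a(1) a\<^sub>0] by simp
  qed
qed

text \<open>The translates of \<open>\<epsilon> a\<^sub>0\<close> by powers of \<open>z\<close> lie,
  modulo \<open>K\<close>, in one finitely generated abelian group, so some monic \<open>p\<close>
  sends \<open>\<epsilon> a\<^sub>0\<close> into \<open>K\<close>. As \<open>\<phi>\<close> maps
  \<open>A\<close> into the module spanned by \<open>a\<^sub>0\<close> over \<open>K\<close>, the
  composite of \<open>p\<close>, \<open>\<epsilon>\<close> and \<open>\<phi>\<close> maps
  \<open>A\<close> into \<open>K\<close>.\<close>

lemma monic_into_submodule:
  assumes fp: "finitely_presented G" and \<phi>: "monic z d \<phi>"
  shows "\<exists>n f. monic z n f \<and> (\<forall>a\<in>A. f a \<in> K)"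
proof -
  obtain S where S: "finite S" "S \<subseteq> A"
    and fin: "\<And>h. h \<in> ops \<Longrightarrow> \<exists>s \<in> generate G S. proj (h (\<epsilon> a\<^sub>0)) = proj s"
    by (rule cyclic_module_finitely_generated[OF fp]) (rule that)
  obtain n where n: "monic z n \<epsilon>" using \<epsilon>_monic[OF \<phi>] by blast
  note \<epsilon> = monic_ops[OF n]
  define x where "x = \<epsilon> a\<^sub>0"
  have x: "x \<in> A" unfolding x_def by (rule ops_closed[OF \<epsilon> a\<^sub>0])
  have "\<exists>m. proj ((act z ^^ m) x) \<in> generate V ((\<lambda>i. proj ((act z ^^ i) x)) ` {..<m})"
  proof (rule V.finitely_generated_sequence_dependent)
    show "finite (proj ` S)" using S by simp
    show "proj ` S \<subseteq> carrier V" using S by auto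
    show "proj ((act z ^^ i) x) \<in> generate V (proj ` S)" for i
      using fin[OF ops_act_power[OF z]] unfolding proj_generate[OF S(2)] x_def by blast
  qed
  then obtain m where m: "proj ((act z ^^ m) x) \<in> generate V ((\<lambda>i. proj ((act z ^^ i) x)) ` {..<m})"
    by blast
  have sub: "(\<lambda>i. (act z ^^ i) x) ` {..<m} \<subseteq> A"
    using x ops_act_power[OF z] by auto
  have "proj ((act z ^^ m) x) \<in> proj ` krylov z m x"
    using m proj_generate[OF sub] by (simp add: krylov_def image_image)
  then obtain u where u: "u \<in> krylov z m x" "proj ((act z ^^ m) x) = proj u" by blast
  have "inv u \<in> krylov z m x"
    by (rule subgroup.m_inv_closed[OF subgroup_krylov[OF z x] u(1)])
  \<comment> \<open>Modulo \<open>K\<close> the \<open>m\<close>-th translate of \<open>x\<close>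
    equals \<open>u\<close>; realizing the inverse of \<open>u\<close> by an operator of degree
    below \<open>m\<close> makes \<open>p\<close> monic with \<open>p x \<in> K\<close>.\<close>
  then obtain r where r: "r \<in> ops" "\<And>a. a \<in> A \<Longrightarrow> r a \<in> krylov z m a" "r x = inv u"
    using krylov_operator[OF z x] by blast
  define p where "p a = (act z ^^ m) a \<otimes> r a" for a
  have p: "monic z m p"
    unfolding p_def[abs_def] by (rule monicI[OF z r(1,2)])
  have uA: "u \<in> A" using u krylov_subset[OF z x] by blast
  have px: "p x \<in> K"
    using u(2) proj_eq_iff[of "(act z ^^ m) x" u] uA ops_closed[OF ops_act_power[OF z] x]
    by (simp add: p_def r(3))
  define q where "q a = p (\<epsilon> a)" for a
  have q: "monic z (m + n) q"
    unfolding q_def[abs_def] by (rule monic_comp[OF z p n])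
  \<comment> \<open>Modulo \<open>K\<close> the element \<open>\<phi> a\<close> is
    \<open>coord a a\<^sub>0\<close>; moreover \<open>q\<close> commutes with
    \<open>coord a\<close>, and \<open>q a\<^sub>0 \<in> K\<close>.\<close>
  have "q (\<phi> a) \<in> K" if a: "a \<in> A" for a
  proof -
    have "q (coord a a\<^sub>0) = coord a (q a\<^sub>0)"
      by (rule ops_commute[OF monic_ops[OF q] coord(1)[OF a] a\<^sub>0])
    also have "\<dots> \<in> K"
      using px unfolding q_def x_def
      by (rule ops_preserves_normal[OF coord(1)[OF a] K_normal K_subset])
    finally have k: "q (coord a a\<^sub>0) \<in> K" .
    have c: "coord a a\<^sub>0 \<in> A" "q (coord a a\<^sub>0) \<in> A" "q (\<phi> a) \<in> A"
      using ops_closed[OF coord(1)[OF a] a\<^sub>0] ops_closed[OF monic_ops[OF q]] a by auto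
    have "proj (q (\<phi> a)) = proj (q (coord a a\<^sub>0))"
      by (rule proj_ops[OF monic_ops[OF q] \<phi>_closed[OF a] c(1) coord(2)[OF a]])
    then have "q (\<phi> a) \<otimes> inv (q (coord a a\<^sub>0)) \<in> K" using c by (simp only: proj_eq_iff)
    then have "q (\<phi> a) \<otimes> inv (q (coord a a\<^sub>0)) \<otimes> q (coord a a\<^sub>0) \<in> K" using k by simp
    then show ?thesis using c by (simp add: m_assoc)
  qed
  then show ?thesis using monic_comp[OF z q \<phi>] by blast
qed

end

section \<open>Descent along a list of module generators\<close>

context inverting_automorphism
begin

primrec ops_spans :: "'a list \<Rightarrow> 'a set" where
  "ops_spans [] = {\<one>}"
| "ops_spans (a # as) = ops_span (ops_spans as) a"

lemma ops_spans:
  assumes "set as \<subseteq> A"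
  shows "ops_spans as \<lhd> G" "ops_spans as \<subseteq> A" "set as \<subseteq> ops_spans as"
proof -
  have "ops_spans as \<lhd> G \<and> ops_spans as \<subseteq> A \<and> set as \<subseteq> ops_spans as"
    using assms
  proof (induction as)
    case Nil
    then show ?case using one_is_normal by simp
  next
    case (Cons a as)
    then show ?case
      using ops_span_normal[of "ops_spans as" a] ops_span_subset[of "ops_spans as" a]
        ops_span_incl[of "ops_spans as" a] by auto
  qed
  then show "ops_spans as \<lhd> G" "ops_spans as \<subseteq> A" "set as \<subseteq> ops_spans as" by blast+
qed

text \<open>Each induction step drops one generator, as \<open>monic_into_submodule\<close> replaces
  \<open>\<phi>\<close> by a monic operator into the smaller submodule. Operator and degree both
  change, hence are generalized. At the empty list the target is trivial.\<close>

lemma monic_annihilator: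
  assumes fp: "finitely_presented G" and z: "z \<in> carrier G"
    and "set as \<subseteq> A" "monic z d \<phi>" "\<And>a. a \<in> A \<Longrightarrow> \<phi> a \<in> ops_spans as"
  shows "\<exists>n f. monic z n f \<and> (\<forall>a\<in>A. f a = \<one>)"
  using assms(3-)
proof (induction as arbitrary: d \<phi>)
  case Nil
  then show ?case by auto
next
  case (Cons a as)
  have as: "set as \<subseteq> A" using Cons.prems(1) by simp
  interpret N: normal "ops_spans as" G by (rule ops_spans(1)[OF as])
  interpret inverting_module_to_cyclic G A \<iota> "ops_spans as" a \<phi> z
  proof unfold_locales
    show "ops_spans as \<subseteq> A" by (rule ops_spans(2)[OF as])
    show "a \<in> A" using Cons.prems(1) by simp
    show "\<phi> \<in> ops" by (rule monic_ops[OF Cons.prems(2)])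
    show "\<phi> b \<in> ops_span (ops_spans as) a" if "b \<in> A" for b
      using Cons.prems(3)[OF that] by simp
    show "z \<in> carrier G" by (rule z)
  qed
  obtain n f where "monic z n f" "\<forall>a\<in>A. f a \<in> ops_spans as"
    using monic_into_submodule[OF fp Cons.prems(2)] by blast
  then show ?case using Cons.IH[of n f] Cons.prems(1) by simp
qed

end

section \<open>From integrality to finite generation of \<open>A\<close>\<close>

context abelian_by_abelian
begin

text \<open>Adjoin the translates of \<open>B\<close> by powers of \<open>z\<close> up to
  \<open>d\<close>. By \<open>dep\<close> their span is stable under \<open>z\<close>. As actions
  commute, it is also stable under each \<open>g\<close> that stabilizes the span of
  \<open>B\<close>, so stability gained earlier is kept.\<close>

lemma finite_invariant_enlargement:
  assumes z: "z \<in> carrier G" and B: "finite B" "B \<subseteq> A"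
    and dep: "\<forall>a\<in>A. (act z ^^ d) a \<in> krylov z d a"
  shows "\<exists>C. finite C \<and> C \<subseteq> A \<and> B \<subseteq> C \<and> (\<forall>c\<in>generate G C. act z c \<in> generate G C) \<and>
    (\<forall>g\<in>carrier G. (\<forall>b\<in>generate G B. act g b \<in> generate G B) \<longrightarrow>
      (\<forall>c\<in>generate G C. act g c \<in> generate G C))"
proof -
  \<comment> \<open>The exponent \<open>d\<close> is included so that \<open>B \<subseteq> C\<close>
    holds also for \<open>d = 0\<close>.\<close>
  define C where "C = (\<Union>i\<le>d. (act z ^^ i) ` B)"
  have C: "finite C" "C \<subseteq> A"
    using B ops_act_power[OF z] by (auto simp: C_def)
  have BC: "B \<subseteq> C" by (force simp: C_def)
  interpret C: subgroup "generate G C" G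
    by (rule generate_is_subgroup) (use C A.subset in blast)
  have pow: "(act z ^^ i) b \<in> generate G C" if "i \<le> d" "b \<in> B" for i b
    using that by (auto simp: C_def intro!: generate.incl)
  have z_inv: "act z c \<in> generate G C" if "c \<in> generate G C" for c
  proof (rule ops_image_generate[OF ops_act[OF z] C(2) C.subgroup_axioms _ that])
    fix c assume "c \<in> C"
    then obtain i b where ib: "i \<le> d" "b \<in> B" "c = (act z ^^ i) b" by (auto simp: C_def)
    then have b: "b \<in> A" using B by blast
    show "act z c \<in> generate G C"
    proof (cases "i = d")
      case False
      then show ?thesis using pow[of "Suc i" b] ib by simp
    next
      case True
      have "(act z ^^ 1) ((act z ^^ d) b) \<in> krylov z (Suc d) b"
        by (rule krylov_shift[OF z b bspec[OF dep b]]) simp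
      moreover have "krylov z (Suc d) b \<subseteq> generate G C"
        using pow[OF _ ib(2)] by (intro krylov_minimal C.subgroup_axioms) auto
      ultimately show ?thesis using ib True by auto
    qed
  qed
  have g_inv: "act g c \<in> generate G C"
    if g: "g \<in> carrier G" and inv: "\<forall>b\<in>generate G B. act g b \<in> generate G B"
      and c: "c \<in> generate G C" for g c
  proof (rule ops_image_generate[OF ops_act[OF g] C(2) C.subgroup_axioms _ c])
    fix c assume "c \<in> C"
    then obtain i b where ib: "i \<le> d" "b \<in> B" "c = (act z ^^ i) b" by (auto simp: C_def)
    have "(act z ^^ i) x \<in> generate G C" if "x \<in> generate G B" for x
      by (rule ops_image_generate[OF ops_act_power[OF z] B(2) C.subgroup_axioms _ that])
        (use pow ib in auto)
    then have "(act z ^^ i) (act g b) \<in> generate G C"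
      using inv ib by (auto intro: generate.incl)
    moreover have "(act z ^^ i) (act g b) = act g c"
      unfolding ib(3) using ops_commute_act[OF ops_act_power[OF z] g] ib B by blast
    ultimately show "act g c \<in> generate G C" by simp
  qed
  show ?thesis
    by (intro exI[of _ C] conjI ballI impI C BC) (simp_all add: z_inv g_inv)
qed

text \<open>Start from the commutators of the generators and enlarge once for each generator and
  each inverse of one. The resulting span is normal and contains the commutators of generators,
  hence all commutators, and so is the derived subgroup.\<close>

lemma finitely_generated_A:
  assumes S: "finite S" "S \<subseteq> carrier G" "generate G S = carrier G"
    and A_eq: "A = derived G (carrier G)"
    and dep: "\<And>z. z \<in> carrier G \<Longrightarrow> \<exists>d. \<forall>a\<in>A. (act z ^^ d) a \<in> krylov z d a"
  shows "\<exists>T. finite T \<and> T \<subseteq> A \<and> generate G T = A"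
proof -
  define B where "B = (\<lambda>(s, t). s \<otimes> t \<otimes> inv s \<otimes> inv t) ` (S \<times> S)"
  have B: "finite B" "B \<subseteq> A"
    using S(1) commutator_in_A subsetD[OF S(2)] by (auto simp: B_def)
  have ex: "\<exists>C. finite C \<and> C \<subseteq> A \<and> B \<subseteq> C \<and> (\<forall>z\<in>Z. \<forall>c\<in>generate G C. act z c \<in> generate G C)"
    if "finite Z" "Z \<subseteq> carrier G" for Z
    using that
  proof (induction Z rule: finite_induct)
    case empty
    then show ?case using B by blast
  next
    case (insert z Z)
    then obtain C where C: "finite C" "C \<subseteq> A" "B \<subseteq> C"
      "\<forall>z\<in>Z. \<forall>c\<in>generate G C. act z c \<in> generate G C" by auto
    have z: "z \<in> carrier G" using insert.prems by simp
    obtain d where d: "\<forall>a\<in>A. (act z ^^ d) a \<in> krylov z d a" using dep[OF z] by blast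
    obtain C' where C': "finite C'" "C' \<subseteq> A" "C \<subseteq> C'"
      "\<forall>c\<in>generate G C'. act z c \<in> generate G C'"
      "\<forall>g\<in>carrier G. (\<forall>b\<in>generate G C. act g b \<in> generate G C) \<longrightarrow>
        (\<forall>c\<in>generate G C'. act g c \<in> generate G C')"
      using finite_invariant_enlargement[OF z C(1,2) d] by (elim exE conjE) (rule that)
    have "act g c \<in> generate G C'" if g: "g \<in> Z" and c: "c \<in> generate G C'" for g c
    proof -
      have "g \<in> carrier G" using g insert.prems by blast
      with C'(5) bspec[OF C(4) g] c show ?thesis by metis
    qed
    then have "\<forall>g\<in>insert z Z. \<forall>c\<in>generate G C'. act g c \<in> generate G C'"
      using C'(4) by simp
    then show ?case using C(3) C'(1-3) by (intro exI[of _ C'] conjI) auto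
  qed
  have "finite (S \<union> (\<lambda>s. inv s) ` S)" "S \<union> (\<lambda>s. inv s) ` S \<subseteq> carrier G"
    using S(1) subsetD[OF S(2)] by auto
  from ex[OF this] obtain C where C: "finite C" "C \<subseteq> A" "B \<subseteq> C"
    and inv: "\<forall>z\<in>S \<union> (\<lambda>s. inv s) ` S. \<forall>c\<in>generate G C. act z c \<in> generate G C"
    by (elim exE conjE) (rule that)
  have CG: "C \<subseteq> carrier G" using C A.subset by blast
  have "generate G C \<lhd> G"
  proof (rule normal_if_normalized_by_generators[OF generate_is_subgroup[OF CG] S(2,3)])
    fix s c assume sc: "s \<in> S" "c \<in> generate G C"
    then have "act s c \<in> generate G C" "act (inv s) c \<in> generate G C" using inv by auto
    moreover have "s \<in> carrier G" using sc S by blast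
    ultimately show "s \<otimes> c \<otimes> inv s \<in> generate G C \<and> inv s \<otimes> c \<otimes> s \<in> generate G C"
      by (simp add: act_def)
  qed
  moreover have "s \<otimes> t \<otimes> inv s \<otimes> inv t \<in> generate G C" if "s \<in> S" "t \<in> S" for s t
    using that C(3) by (force simp: B_def intro: generate.incl)
  ultimately have comm: "g \<otimes> h \<otimes> inv g \<otimes> inv h \<in> generate G C"
    if "g \<in> carrier G" "h \<in> carrier G" for g h
    using commutators_in_normal[OF _ S(2,3)] that by blast
  have "A \<subseteq> generate G C"
    unfolding A_eq derived_def
    using comm by (intro generate_subgroup_incl generate_is_subgroup[OF CG]) auto
  moreover have "generate G C \<subseteq> A" by (rule generate_subgroup_incl[OF C(2) A.subgroup_axioms])
  ultimately show ?thesis using C by blast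
qed

end

text \<open>The commutators of the generators generate \<open>A\<close> as a module, so the descent
  can start from the identity, which is monic of degree \<open>0\<close>. The monic annihilator of
  each \<open>z\<close> then makes \<open>A\<close> finitely generated as an abelian group.\<close>

theorem (in inverting_automorphism) finitely_presented_imp_polycyclic:
  assumes fp: "finitely_presented G" and A_eq: "A = derived G (carrier G)"
    and S: "finite S" "S \<subseteq> carrier G" "generate G S = carrier G"
  shows "polycyclic G"
proof -
  obtain as where as: "set as = (\<lambda>(s, t). s \<otimes> t \<otimes> inv s \<otimes> inv t) ` (S \<times> S)"
    using finite_list[of "(\<lambda>(s, t). s \<otimes> t \<otimes> inv s \<otimes> inv t) ` (S \<times> S)"] S by blast
  have as_A: "set as \<subseteq> A"
    using commutator_in_A subsetD[OF S(2)] unfolding as by auto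
  note N = ops_spans[OF as_A]
  have "s \<otimes> t \<otimes> inv s \<otimes> inv t \<in> ops_spans as" if "s \<in> S" "t \<in> S" for s t
    using that N(3) as by force
  then have comm: "g \<otimes> h \<otimes> inv g \<otimes> inv h \<in> ops_spans as"
    if "g \<in> carrier G" "h \<in> carrier G" for g h
    using commutators_in_normal[OF N(1) S(2,3)] that by blast
  have A_spans: "A \<subseteq> ops_spans as"
    unfolding A_eq derived_def
    using comm by (intro generate_subgroup_incl normal_imp_subgroup[OF N(1)]) auto
  have "\<exists>d. \<forall>a\<in>A. (act z ^^ d) a \<in> krylov z d a" if z: "z \<in> carrier G" for z
  proof -
    obtain n f where f: "monic z n f" "\<forall>a\<in>A. f a = \<one>"
      using monic_annihilator[OF fp z as_A monic_id] A_spans by blast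
    have "(act z ^^ n) a \<in> krylov z n a" if a: "a \<in> A" for a
    proof -
      obtain u where u: "u \<in> krylov z n a" "\<one> = (act z ^^ n) a \<otimes> u"
        using f a unfolding monic_def by metis
      have "u \<in> A" "(act z ^^ n) a \<in> A"
        using u krylov_subset[OF z a] ops_closed[OF ops_act_power[OF z] a] by blast+
      then have "(act z ^^ n) a = inv u" using u(2) inv_equality[of "(act z ^^ n) a" u] by simp
      then show ?thesis using subgroup.m_inv_closed[OF subgroup_krylov[OF z a] u(1)] by simp
    qed
    then show ?thesis by blast
  qed
  then obtain T where T: "finite T" "T \<subseteq> A" "generate G T = A"
    using finitely_generated_A[OF S A_eq] by blast
  show ?thesis
    by (rule polycyclic_if_abelian_by_abelian[OF S T(1)])
      (use T A.subset A_commute commutator_in_A in auto)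
qed

theorem theorem3p1:
  fixes G :: "('a, 'b) monoid_scheme"
  assumes "group G"
    and "finitely_generated G"
    and "metabelian G"
    and "\<exists>\<iota> \<in> iso G G. \<forall>g \<in> carrier G.
           derived G (carrier G) #>\<^bsub>G\<^esub> \<iota> g = derived G (carrier G) #>\<^bsub>G\<^esub> (inv\<^bsub>G\<^esub> g)"
  shows "finitely_presented G \<longleftrightarrow> polycyclic G"
proof
  interpret group G by fact
  show "finitely_presented G" if "polycyclic G"
    using that by (rule polycyclic_imp_finitely_presented)
  assume fp: "finitely_presented G"
  let ?A = "derived G (carrier G)"
  obtain \<iota> where \<iota>: "\<iota> \<in> iso G G"
    "\<And>g. g \<in> carrier G \<Longrightarrow> ?A #>\<^bsub>G\<^esub> \<iota> g = ?A #>\<^bsub>G\<^esub> (inv\<^bsub>G\<^esub> g)"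
    using assms(4) by blast
  obtain S where S: "finite S" "S \<subseteq> carrier G" "generate G S = carrier G"
    using assms(2) unfolding finitely_generated_def by blast
  interpret A: normal ?A G by (rule derived_self_is_normal)
  interpret \<iota>: group_hom G G \<iota> using \<iota>(1) by unfold_locales (simp add: iso_def)
  have \<iota>_surj: "\<iota> ` carrier G = carrier G" using \<iota>(1) by (simp add: iso_def bij_betw_def)
  \<comment> \<open>With \<open>A\<close> the derived subgroup, commutativity of \<open>A\<close>
    holds because its commutators lie in the trivial second derived subgroup.\<close>
  interpret inverting_automorphism G ?A \<iota>
  proof unfold_locales
    fix a b assume ab: "a \<in> ?A" "b \<in> ?A"
    then have "a \<otimes>\<^bsub>G\<^esub> b \<otimes>\<^bsub>G\<^esub> inv\<^bsub>G\<^esub> a \<otimes>\<^bsub>G\<^esub> inv\<^bsub>G\<^esub> b \<in> derived G ?A"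
      unfolding derived_def[of G "derived G (carrier G)"] by (intro generate.incl) blast
    then have "a \<otimes>\<^bsub>G\<^esub> b \<otimes>\<^bsub>G\<^esub> inv\<^bsub>G\<^esub> a \<otimes>\<^bsub>G\<^esub> inv\<^bsub>G\<^esub> b = \<one>\<^bsub>G\<^esub>"
      using assms(3) by (simp add: metabelian_def)
    then have "(a \<otimes>\<^bsub>G\<^esub> b) \<otimes>\<^bsub>G\<^esub> inv\<^bsub>G\<^esub> (b \<otimes>\<^bsub>G\<^esub> a) = \<one>\<^bsub>G\<^esub>"
      using ab by (simp add: inv_mult_group m_assoc)
    then have "inv\<^bsub>G\<^esub> (inv\<^bsub>G\<^esub> (b \<otimes>\<^bsub>G\<^esub> a)) = a \<otimes>\<^bsub>G\<^esub> b"
      using ab by (intro inv_equality) auto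
    then show "a \<otimes>\<^bsub>G\<^esub> b = b \<otimes>\<^bsub>G\<^esub> a" using ab by simp
  next
    fix g h assume "g \<in> carrier G" "h \<in> carrier G"
    then show "g \<otimes>\<^bsub>G\<^esub> h \<otimes>\<^bsub>G\<^esub> inv\<^bsub>G\<^esub> g \<otimes>\<^bsub>G\<^esub> inv\<^bsub>G\<^esub> h \<in> ?A"
      unfolding derived_def by (intro generate.incl) blast
  next
    show "\<iota> \<in> iso G G" by (rule \<iota>(1))
    show "\<iota> ` ?A = ?A" using \<iota>.derived_img[of "carrier G"] \<iota>_surj by simp
    fix g assume g: "g \<in> carrier G"
    \<comment> \<open>Equality of the cosets of \<open>\<iota> g\<close> and of the inverse of
      \<open>g\<close> is rephrased as membership of the product of \<open>\<iota> g\<close> and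
      \<open>g\<close> in \<open>?A\<close>.\<close>
    have "\<iota> g \<in> ?A #>\<^bsub>G\<^esub> (inv\<^bsub>G\<^esub> g)"
      using rcos_self[OF \<iota>.hom_closed[OF g] A.subgroup_axioms] \<iota>(2)[OF g] by simp
    then show "\<iota> g \<otimes>\<^bsub>G\<^esub> g \<in> ?A"
      using A.rcos_module[OF is_group inv_closed[OF g] \<iota>.hom_closed[OF g]] g by simp
  qed
  show "polycyclic G" by (rule finitely_presented_imp_polycyclic[OF fp refl S])
qed

end
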